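(* Internally in the effective topos ${\cal E}\!f\!f$, the preorder $(M^*,\leq)$ is the free completion of the preorder $(\nabla(\mathcal P^*\mathcal P(\mathbb N)),\leq)$, along the map ${\cal A}\mapsto G_{\cal A}$, under joins indexed by nonempty subsets of $N$.
   Context: Notation: for $e,x\in\mathbb N$, $ex$ denotes the (possibly undefined) result of applying the $e$-th partial recursive function to $x$; $\langle\cdot,\ldots,\cdot\rangle$ is a standard recursive coding of finite sequences. For $A,B\subseteq\mathbb N$: $A\wedge B=\{\langle a,b\rangle\mid a\in A,b\in B\}$, $A\to B=\{e\mid \text{for all }a\in A,\ ea\text{ is defined and in }B\}$. $\mathcal P^*(X)$ denotes the set of nonempty subsets of $X$. For $f:\mathcal P(\mathbb N)\to\mathcal P(\mathbb N)$ let $E(f)=\bigcap_{p,q\subseteq\mathbb N}\big((p\to q)\to(f(p)\to f(q))\big)$; $M$ is the set of such $f$ with $E(f)\neq\emptyset$ and $M^*\subseteq M$ consists of those $f$ with $\bigcup_{p}f(p)\neq\emptyset$. In ${\cal E}\!f\!f$, $M^*$ is regarded as the assembly with underlying set $M^*$ and existence predicate $E$, with internal preorder $[f\le g]=E(f)\wedge E(g)\wedge\bigcap_{p\subseteq\mathbb N}(f(p)\to g(p))$. The sheaf $\nabla(\mathcal P^*\mathcal P(\mathbb N))$ carries the internal preorder $[{\cal A}\le{\cal B}]=\{k\mid \forall A\in{\cal A}\,\exists B\in{\cal B}\,(k\in B\to A)\}$, and for ${\cal A}\in\mathcal P^*\mathcal P(\mathbb N)$, $G_{\cal A}(p)=\bigcup_{A\in{\cal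 A}}(A\to p)$ (this gives an order-embedding $\nabla(\mathcal P^*\mathcal P(\mathbb N))\to M^*$). Internally, a subobject $A$ of the natural numbers object $N$ is called nonempty if $\neg\neg\exists n\,(n\in A)$; the object of such subobjects is $\nabla(\mathcal P^*(\mathbb N))$ with $[n\in A]=\{n\mid n\in A\}$. *)

theory Defs
  imports Main "HOL-Library.Nat_Bijection"
begin

section \<open>Partial recursive functions and a Goedel numbering\<close>

text \<open>
  Unary partial recursive functions, presented through the pairing bijection
  \<^const>\<open>prod_encode\<close>: basic functions, pairing, composition, primitive recursion with a
  parameter, and minimisation. The numbering \<open>index\<close> is an explicit bijection between
  such presentations and the natural numbers.
\<close>

datatype recf =
    Zero | Succ | Left | Right
  | Pairing recf recf | Comp recf recf | PrimRec recf recf | Mu recf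

primrec eval :: "recf \<Rightarrow> nat \<Rightarrow> nat option" where
  "eval Zero x = Some 0"
| "eval Succ x = Some (Suc x)"
| "eval Left x = Some (fst (prod_decode x))"
| "eval Right x = Some (snd (prod_decode x))"
| "eval (Pairing c d) x =
     Option.bind (eval c x) (\<lambda>a. Option.bind (eval d x) (\<lambda>b. Some (prod_encode (a, b))))"
| "eval (Comp c d) x = Option.bind (eval d x) (eval c)"
| "eval (PrimRec c d) x =
     (case prod_decode x of (a, n) \<Rightarrow>
        rec_nat (eval c a)
          (\<lambda>k r. Option.bind r (\<lambda>v. eval d (prod_encode (a, prod_encode (k, v))))) n)"
| "eval (Mu c) x =
     (if \<exists>n. eval c (prod_encode (x, n)) = Some 0 \<and> (\<forall>k<n. eval c (prod_encode (x, k)) \<noteq> None)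
      then Some (LEAST n. eval c (prod_encode (x, n)) = Some 0) else None)"

primrec index :: "recf \<Rightarrow> nat" where
  "index Zero = 0"
| "index Succ = 1"
| "index Left = 2"
| "index Right = 3"
| "index (Pairing c d) = 4 * prod_encode (index c, index d) + 4"
| "index (Comp c d) = 4 * prod_encode (index c, index d) + 5"
| "index (PrimRec c d) = 4 * prod_encode (index c, index d) + 6"
| "index (Mu c) = 4 * index c + 7"

lemma index_inj: "index c = index d \<Longrightarrow> c = d"
proof (induction c arbitrary: d)
  case (Pairing c1 c2)
  then show ?case by (cases d; simp; presburger?)
next
  case (Comp c1 c2)
  then show ?case by (cases d; simp; presburger?)
next
  case (PrimRec c1 c2)
  then show ?case by (cases d; simp; presburger?)
next
  case (Mu c)
  then show ?case by (cases d; simp; presburger?)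
qed (case_tac d; simp)+

lemma index_surj: "\<exists>c. index c = n"
proof (induction n rule: less_induct)
  case (less n)
  show ?case
  proof (cases "n < 4")
    case True
    then have "n = index Zero \<or> n = index Succ \<or> n = index Left \<or> n = index Right" by auto
    then show ?thesis by metis
  next
    case False
    define q where "q = (n - 4) div 4"
    obtain a b where ab: "prod_encode (a, b) = q" by (metis prod_decode_inverse surj_pair)
    have "a \<le> q" "b \<le> q" using ab le_prod_encode_1 le_prod_encode_2 by blast+
    moreover have "q < n" using False by (simp add: q_def)
    ultimately obtain c d e where *: "index c = a" "index d = b" "index e = q"
      using less by (meson le_less_trans)
    have "n = 4 * q + 4 \<or> n = 4 * q + 5 \<or> n = 4 * q + 6 \<or> n = 4 * q + 7"
      using False unfolding q_def by presburger
    then have "n = index (Pairing c d) \<or> n = index (Comp c d) \<or> n = index (PrimRec c d)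
        \<or> n = index (Mu e)"
      using * ab by simp
    then show ?thesis by metis
  qed
qed

lemma bij_index: "bij index"
  by (meson bijI index_inj index_surj injI surjI surj_def)

definition app :: "nat \<Rightarrow> nat \<Rightarrow> nat option" where
  "app e x = eval (inv index e) x"


section \<open>Realizability connectives and the internal language of the effective topos\<close>

text \<open>
  A proposition is interpreted as its set of realizers. An object of the effective topos with
  underlying set \<open>'x\<close> is given by its equality predicate
  \<open>X :: 'x \<Rightarrow> 'x \<Rightarrow> nat set\<close>; its existence predicate is the diagonal of \<open>X\<close>, so elements of
  \<open>'x\<close> with \<open>X x x = {}\<close> do not count. Quantifiers are relativised to existence predicates.
\<close>

definition rconj :: "nat set \<Rightarrow> nat set \<Rightarrow> nat set" (infixr "\<^bold>\<and>" 62) where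
  "A \<^bold>\<and> B = {prod_encode (a, b) | a b. a \<in> A \<and> b \<in> B}"

definition rimp :: "nat set \<Rightarrow> nat set \<Rightarrow> nat set" (infixr "\<^bold>\<longrightarrow>" 61) where
  "(A \<^bold>\<longrightarrow> B) = {e. \<forall>a\<in>A. \<exists>b\<in>B. app e a = Some b}"

definition rall :: "('x \<Rightarrow> nat set) \<Rightarrow> ('x \<Rightarrow> nat set) \<Rightarrow> nat set" where
  "rall ex \<phi> = (\<Inter>x. (ex x \<^bold>\<longrightarrow> \<phi> x))"

definition rex :: "('x \<Rightarrow> nat set) \<Rightarrow> ('x \<Rightarrow> nat set) \<Rightarrow> nat set" where
  "rex ex \<phi> = (\<Union>x. (ex x \<^bold>\<and> \<phi> x))"

definition valid :: "nat set \<Rightarrow> bool" where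
  "valid \<phi> \<longleftrightarrow> \<phi> \<noteq> {}"

definition el :: "('x \<Rightarrow> 'x \<Rightarrow> nat set) \<Rightarrow> 'x \<Rightarrow> nat set" where
  "el X x = X x x"

definition is_object :: "('x \<Rightarrow> 'x \<Rightarrow> nat set) \<Rightarrow> nat set" where
  "is_object X =
     ((\<Inter>x y. (X x y \<^bold>\<longrightarrow> X y x)) \<^bold>\<and>
      (\<Inter>x y z. ((X x y \<^bold>\<and> X y z) \<^bold>\<longrightarrow> X x z)))"

text \<open>
  The existence predicate of the exponential \<open>Y\<^sup>X\<close>: its elements are the functional relations,
  that is, those \<open>F\<close> that are strict, extensional, single-valued and total.
\<close>

definition func :: "('x \<Rightarrow> 'x \<Rightarrow> nat set) \<Rightarrow> ('y \<Rightarrow> 'y \<Rightarrow> nat set) \<Rightarrow> ('x \<Rightarrow> 'y \<Rightarrow> nat set) \<Rightarrow> nat set" where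
  "func X Y F =
     ((\<Inter>x y. (F x y \<^bold>\<longrightarrow> (X x x \<^bold>\<and> Y y y))) \<^bold>\<and>
      (\<Inter>x x' y y'. ((F x y \<^bold>\<and> X x x' \<^bold>\<and> Y y y') \<^bold>\<longrightarrow> F x' y')) \<^bold>\<and>
      (\<Inter>x y y'. ((F x y \<^bold>\<and> F x y') \<^bold>\<longrightarrow> Y y y')) \<^bold>\<and>
      rall (el X) (\<lambda>x. rex (el Y) (\<lambda>y. F x y)))"

definition func_comp :: "('y \<Rightarrow> 'y \<Rightarrow> nat set) \<Rightarrow> ('y \<Rightarrow> 'z \<Rightarrow> nat set) \<Rightarrow> ('x \<Rightarrow> 'y \<Rightarrow> nat set) \<Rightarrow> 'x \<Rightarrow> 'z \<Rightarrow> nat set" where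
  "func_comp Y F H = (\<lambda>x z. rex (el Y) (\<lambda>y. H x y \<^bold>\<and> F y z))"

definition assembly :: "'x set \<Rightarrow> ('x \<Rightarrow> nat set) \<Rightarrow> 'x \<Rightarrow> 'x \<Rightarrow> nat set" where
  "assembly S ex x y = (if x = y \<and> x \<in> S then ex x else {})"

definition nabla :: "'x set \<Rightarrow> 'x \<Rightarrow> 'x \<Rightarrow> nat set" where
  "nabla S = assembly S (\<lambda>_. UNIV)"

text \<open>The graph of the morphism of assemblies induced by a map \<open>g\<close> of underlying sets.\<close>

definition graph :: "('x \<Rightarrow> 'x \<Rightarrow> nat set) \<Rightarrow> ('y \<Rightarrow> 'y \<Rightarrow> nat set) \<Rightarrow> ('x \<Rightarrow> 'y) \<Rightarrow> 'x \<Rightarrow> 'y \<Rightarrow> nat set" where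
  "graph X Y g = (\<lambda>x y. X x x \<^bold>\<and> Y (g x) y)"


section \<open>Internal preorders, joins and free completions\<close>

definition preord :: "('x \<Rightarrow> 'x \<Rightarrow> nat set) \<Rightarrow> ('x \<Rightarrow> 'x \<Rightarrow> nat set) \<Rightarrow> nat set" where
  "preord X le =
     (is_object X \<^bold>\<and>
      (\<Inter>x y. (le x y \<^bold>\<longrightarrow> (X x x \<^bold>\<and> X y y))) \<^bold>\<and>
      (\<Inter>x x' y y'. ((le x y \<^bold>\<and> X x x' \<^bold>\<and> X y y') \<^bold>\<longrightarrow> le x' y')) \<^bold>\<and>
      rall (el X) (\<lambda>x. le x x) \<^bold>\<and>
      rall (el X) (\<lambda>x. rall (el X) (\<lambda>y. rall (el X) (\<lambda>z. (le x y \<^bold>\<and> le y z) \<^bold>\<longrightarrow> le x z))))"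

definition monotone_fun ::
  "('x \<Rightarrow> 'x \<Rightarrow> nat set) \<Rightarrow> ('x \<Rightarrow> 'x \<Rightarrow> nat set) \<Rightarrow> ('y \<Rightarrow> 'y \<Rightarrow> nat set) \<Rightarrow> ('y \<Rightarrow> 'y \<Rightarrow> nat set)
   \<Rightarrow> ('x \<Rightarrow> 'y \<Rightarrow> nat set) \<Rightarrow> nat set" where
  "monotone_fun X leX Y leY F =
     rall (el X) (\<lambda>x. rall (el X) (\<lambda>x'. rall (el Y) (\<lambda>y. rall (el Y) (\<lambda>y'.
       (F x y \<^bold>\<and> F x' y' \<^bold>\<and> leX x x') \<^bold>\<longrightarrow> leY y y'))))"

text \<open>
  The object of nonempty subobjects of \<open>N\<close> is \<open>nabla {A. A \<noteq> {}}\<close>; the subobject named by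
  \<open>A\<close> is the assembly on \<open>A\<close> in which \<open>n\<close> is realized by \<open>n\<close> only. A family in \<open>Y\<close> indexed
  by \<open>A\<close> is an internal function from \<open>subN A\<close> to \<open>Y\<close>.
\<close>

definition nonempty_subsets :: "nat set \<Rightarrow> nat set \<Rightarrow> nat set" where
  "nonempty_subsets = nabla {A. A \<noteq> {}}"

definition subN :: "nat set \<Rightarrow> nat \<Rightarrow> nat \<Rightarrow> nat set" where
  "subN A = assembly A (\<lambda>n. {n})"

definition upper_bound ::
  "('y \<Rightarrow> 'y \<Rightarrow> nat set) \<Rightarrow> ('y \<Rightarrow> 'y \<Rightarrow> nat set) \<Rightarrow> nat set \<Rightarrow> (nat \<Rightarrow> 'y \<Rightarrow> nat set) \<Rightarrow> 'y \<Rightarrow> nat set" where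
  "upper_bound Y le A \<phi> z =
     rall (el (subN A)) (\<lambda>n. rall (el Y) (\<lambda>y. \<phi> n y \<^bold>\<longrightarrow> le y z))"

definition is_join ::
  "('y \<Rightarrow> 'y \<Rightarrow> nat set) \<Rightarrow> ('y \<Rightarrow> 'y \<Rightarrow> nat set) \<Rightarrow> nat set \<Rightarrow> (nat \<Rightarrow> 'y \<Rightarrow> nat set) \<Rightarrow> 'y \<Rightarrow> nat set" where
  "is_join Y le A \<phi> z =
     (upper_bound Y le A \<phi> z \<^bold>\<and>
      rall (el Y) (\<lambda>w. upper_bound Y le A \<phi> w \<^bold>\<longrightarrow> le z w))"

definition has_joins :: "('y \<Rightarrow> 'y \<Rightarrow> nat set) \<Rightarrow> ('y \<Rightarrow> 'y \<Rightarrow> nat set) \<Rightarrow> nat set" where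
  "has_joins Y le =
     rall (el nonempty_subsets) (\<lambda>A. rall (func (subN A) Y) (\<lambda>\<phi>.
       rex (el Y) (\<lambda>z. is_join Y le A \<phi> z)))"

definition preserves_joins ::
  "('x \<Rightarrow> 'x \<Rightarrow> nat set) \<Rightarrow> ('x \<Rightarrow> 'x \<Rightarrow> nat set) \<Rightarrow> ('y \<Rightarrow> 'y \<Rightarrow> nat set) \<Rightarrow> ('y \<Rightarrow> 'y \<Rightarrow> nat set)
   \<Rightarrow> ('x \<Rightarrow> 'y \<Rightarrow> nat set) \<Rightarrow> nat set" where
  "preserves_joins X leX Y leY F =
     rall (el nonempty_subsets) (\<lambda>A. rall (func (subN A) X) (\<lambda>\<phi>. rall (el X) (\<lambda>z.
       is_join X leX A \<phi> z \<^bold>\<longrightarrow>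
         rall (el Y) (\<lambda>w. F z w \<^bold>\<longrightarrow> is_join Y leY A (func_comp X F \<phi>) w))))"

definition iso :: "('y \<Rightarrow> 'y \<Rightarrow> nat set) \<Rightarrow> 'y \<Rightarrow> 'y \<Rightarrow> nat set" where
  "iso le y y' = (le y y' \<^bold>\<and> le y' y)"

text \<open>Pointwise isomorphism of two internal functions into a preorder.\<close>

definition iso_fun ::
  "('x \<Rightarrow> 'x \<Rightarrow> nat set) \<Rightarrow> ('y \<Rightarrow> 'y \<Rightarrow> nat set) \<Rightarrow> ('y \<Rightarrow> 'y \<Rightarrow> nat set)
   \<Rightarrow> ('x \<Rightarrow> 'y \<Rightarrow> nat set) \<Rightarrow> ('x \<Rightarrow> 'y \<Rightarrow> nat set) \<Rightarrow> nat set" where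
  "iso_fun X Y leY F F' =
     rall (el X) (\<lambda>x. rall (el Y) (\<lambda>y. rall (el Y) (\<lambda>y'.
       (F x y \<^bold>\<and> F' x y') \<^bold>\<longrightarrow> iso leY y y')))"

text \<open>\<open>F : Q \<rightarrow> Y\<close> is a monotone, join-preserving extension of \<open>h : P \<rightarrow> Y\<close> along \<open>G : P \<rightarrow> Q\<close>.\<close>

definition is_extension ::
  "('p \<Rightarrow> 'p \<Rightarrow> nat set) \<Rightarrow> ('q \<Rightarrow> 'q \<Rightarrow> nat set) \<Rightarrow> ('q \<Rightarrow> 'q \<Rightarrow> nat set)
   \<Rightarrow> ('p \<Rightarrow> 'q \<Rightarrow> nat set) \<Rightarrow> ('y \<Rightarrow> 'y \<Rightarrow> nat set) \<Rightarrow> ('y \<Rightarrow> 'y \<Rightarrow> nat set)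
   \<Rightarrow> ('p \<Rightarrow> 'y \<Rightarrow> nat set) \<Rightarrow> ('q \<Rightarrow> 'y \<Rightarrow> nat set) \<Rightarrow> nat set" where
  "is_extension P Q leQ G Y leY h F =
     (monotone_fun Q leQ Y leY F \<^bold>\<and>
      preserves_joins Q leQ Y leY F \<^bold>\<and>
      iso_fun P Y leY (func_comp Q F G) h)"

text \<open>
  The intersection over all \<open>Y\<close> and \<open>leY\<close> on the set \<open>'y\<close>, guarded by realizers of
  \<open>preord Y leY\<close>, is the Kripke-Joyal (stack) reading of the internal quantification over
  all preorders: it ranges over arbitrary families of preorders over an arbitrary base object
  whose members are carried by \<open>'y\<close>, not just over the global ones. The type argument makes the
  carrier \<open>'y\<close>, over which the theorem is polymorphic, explicit.
\<close>

definition universal_property ::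
  "'y itself \<Rightarrow> ('p \<Rightarrow> 'p \<Rightarrow> nat set) \<Rightarrow> ('p \<Rightarrow> 'p \<Rightarrow> nat set)
   \<Rightarrow> ('q \<Rightarrow> 'q \<Rightarrow> nat set) \<Rightarrow> ('q \<Rightarrow> 'q \<Rightarrow> nat set) \<Rightarrow> ('p \<Rightarrow> 'q \<Rightarrow> nat set) \<Rightarrow> nat set" where
  "universal_property _ P leP Q leQ G =
     (\<Inter>(Y :: 'y \<Rightarrow> 'y \<Rightarrow> nat set) (leY :: 'y \<Rightarrow> 'y \<Rightarrow> nat set).
       (preord Y leY \<^bold>\<and> has_joins Y leY) \<^bold>\<longrightarrow>
       rall (func P Y) (\<lambda>h. monotone_fun P leP Y leY h \<^bold>\<longrightarrow>
         (rex (func Q Y) (\<lambda>F. is_extension P Q leQ G Y leY h F) \<^bold>\<and>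
          rall (func Q Y) (\<lambda>F. rall (func Q Y) (\<lambda>F'.
            (is_extension P Q leQ G Y leY h F \<^bold>\<and> is_extension P Q leQ G Y leY h F')
              \<^bold>\<longrightarrow> iso_fun Q Y leY F F')))))"

definition free_completion ::
  "'y itself \<Rightarrow> ('p \<Rightarrow> 'p \<Rightarrow> nat set) \<Rightarrow> ('p \<Rightarrow> 'p \<Rightarrow> nat set)
   \<Rightarrow> ('q \<Rightarrow> 'q \<Rightarrow> nat set) \<Rightarrow> ('q \<Rightarrow> 'q \<Rightarrow> nat set) \<Rightarrow> ('p \<Rightarrow> 'q \<Rightarrow> nat set) \<Rightarrow> nat set" where
  "free_completion T P leP Q leQ G =
     (preord P leP \<^bold>\<and> preord Q leQ \<^bold>\<and> has_joins Q leQ \<^bold>\<and>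
      func P Q G \<^bold>\<and> monotone_fun P leP Q leQ G \<^bold>\<and>
      universal_property T P leP Q leQ G)"


section \<open>The two preorders and the map between them\<close>

definition E :: "(nat set \<Rightarrow> nat set) \<Rightarrow> nat set" where
  "E f = (\<Inter>p q. ((p \<^bold>\<longrightarrow> q) \<^bold>\<longrightarrow> (f p \<^bold>\<longrightarrow> f q)))"

definition M :: "(nat set \<Rightarrow> nat set) set" where
  "M = {f. E f \<noteq> {}}"

definition Mstar :: "(nat set \<Rightarrow> nat set) set" where
  "Mstar = {f \<in> M. (\<Union>p. f p) \<noteq> {}}"

definition Mstar_obj :: "(nat set \<Rightarrow> nat set) \<Rightarrow> (nat set \<Rightarrow> nat set) \<Rightarrow> nat set" where
  "Mstar_obj = assembly Mstar E"

definition Mstar_le :: "(nat set \<Rightarrow> nat set) \<Rightarrow> (nat set \<Rightarrow> nat set) \<Rightarrow> nat set" where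
  "Mstar_le f g =
     (if f \<in> Mstar \<and> g \<in> Mstar then E f \<^bold>\<and> E g \<^bold>\<and> (\<Inter>p. (f p \<^bold>\<longrightarrow> g p)) else {})"

definition PP_obj :: "nat set set \<Rightarrow> nat set set \<Rightarrow> nat set" where
  "PP_obj = nabla {\<A>. \<A> \<noteq> {}}"

definition PP_le :: "nat set set \<Rightarrow> nat set set \<Rightarrow> nat set" where
  "PP_le \<A> \<B> =
     (if \<A> \<noteq> {} \<and> \<B> \<noteq> {} then {k. \<forall>A\<in>\<A>. \<exists>B\<in>\<B>. k \<in> (B \<^bold>\<longrightarrow> A)} else {})"

definition G :: "nat set set \<Rightarrow> nat set \<Rightarrow> nat set" where
  "G \<A> p = (\<Union>A\<in>\<A>. (A \<^bold>\<longrightarrow> p))"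

end

theory Submission
  imports Defs
begin

text \<open>
  A subobject of \<open>N\<close> is projective, so a family indexed by \<open>A\<close> amounts to a function on \<open>A\<close>, and in
  \<open>M\<^sup>*\<close> the join of \<open>(g\<^sub>n)\<close> is \<open>p \<mapsto> {\<langle>n, m\<rangle> | n \<in> A, m \<in> g\<^sub>n(p)}\<close>. Every \<open>f \<in> M\<^sup>*\<close> is the join of
  the \<open>G(\<A>\<^sub>n)\<close> with \<open>\<A>\<^sub>n = {p | n \<in> f(p)}\<close>, indexed by the nonempty set \<open>\<Union>\<^sub>p f(p)\<close>: from \<open>k \<in> p \<rightarrow> q\<close>
  and \<open>n \<in> f(p)\<close> a realizer of \<open>E(f)\<close> computes an element of \<open>f(q)\<close>, and conversely \<open>n \<in> f(p)\<close> puts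
  the identity into \<open>G(\<A>\<^sub>n)(p)\<close>. Hence an extension of \<open>h\<close> is determined up to isomorphism, and it
  must send \<open>f\<close> to the join of the \<open>h(\<A>\<^sub>n)\<close>. The realizers of these joins do not depend on \<open>f\<close>, so the
  joins can be chosen externally. This choice is monotone because a realizer \<open>c\<close> of \<open>f \<le> g\<close> satisfies
  \<open>\<A>\<^sub>n \<subseteq> {p | c n \<in> g(p)}\<close>, and preserves joins because a realizer of \<open>f \<le> \<Or>\<^sub>n g\<^sub>n\<close> splits each \<open>\<A>\<^sub>m\<close>
  along the \<open>g\<^sub>n\<close>.
\<close>

section \<open>Total recursive functions\<close>

text \<open>Validity asks for a single number that works uniformly for all preorders on
  \<open>'y\<close>, all index sets and all families. Every argument is therefore carried by an
  explicit realizer, written as an applicative term with bracket abstraction; this is why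
  combinators, and before them a universal function for the numbering, have to be built. The
  obstacle is that internal functions are relations whose values are determined only up to the
  equality of \<open>Y\<close>, and that joins in \<open>Y\<close> are merely asserted to exist.
  Over a \<open>nabla\<close> object every number realizes existence, so feeding in \<open>0\<close>
  yields one number for all arguments, and for each argument a value realized by it can be picked.
  The picked values satisfy no coherence; it is recovered from leastness of joins. Fibres work
  because the order on \<open>Mstar\<close> intersects over all \<open>p\<close>: a tracking number
  never sees \<open>p\<close>, so it moves a whole fibre into one fibre. Nonemptiness carries no
  computational content either: it only ensures that sets and functions belong to the objects in
  question.\<close>

definition trec :: "(nat \<Rightarrow> nat) \<Rightarrow> bool" where
  "trec f \<longleftrightarrow> (\<exists>c. \<forall>x. eval c x = Some (f x))"

abbreviation pe :: "nat \<Rightarrow> nat \<Rightarrow> nat" where "pe a b \<equiv> prod_encode (a, b)"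
abbreviation p1 :: "nat \<Rightarrow> nat" where "p1 z \<equiv> fst (prod_decode z)"
abbreviation p2 :: "nat \<Rightarrow> nat" where "p2 z \<equiv> snd (prod_decode z)"

lemma pe_p1_p2 [simp]: "pe (p1 z) (p2 z) = z"
  by simp

lemma trec_id: "trec (\<lambda>x. x)"
  unfolding trec_def by (rule exI[of _ "Pairing Left Right"]) simp

lemma trec_const: "trec (\<lambda>x. n)"
proof (induction n)
  case 0
  show ?case unfolding trec_def by (rule exI[of _ Zero]) simp
next
  case (Suc n)
  then obtain c where "\<forall>x. eval c x = Some n" unfolding trec_def by blast
  then show ?case unfolding trec_def by (intro exI[of _ "Comp Succ c"]) simp
qed

lemma trec_comp: "trec f \<Longrightarrow> trec g \<Longrightarrow> trec (\<lambda>x. f (g x))"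
  unfolding trec_def by (metis eval.simps(6) bind.bind_lunit)

lemma trec_Suc: "trec f \<Longrightarrow> trec (\<lambda>x. Suc (f x))"
  by (rule trec_comp[of Suc]) (auto simp: trec_def intro: exI[of _ Succ])

lemma trec_p1: "trec f \<Longrightarrow> trec (\<lambda>x. p1 (f x))"
  by (rule trec_comp[of p1]) (auto simp: trec_def intro: exI[of _ Left])

lemma trec_p2: "trec f \<Longrightarrow> trec (\<lambda>x. p2 (f x))"
  by (rule trec_comp[of p2]) (auto simp: trec_def intro: exI[of _ Right])

lemma trec_pe: "trec f \<Longrightarrow> trec g \<Longrightarrow> trec (\<lambda>x. pe (f x) (g x))"
  unfolding trec_def by (metis eval.simps(5) bind.bind_lunit)

text \<open>The premise on \<open>g\<close> has the shape in which \<open>PrimRec\<close> passes its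
  data: parameter, counter and previous value, nested to the right.\<close>

lemma trec_rec:
  assumes f: "trec f" and n: "trec n" and g: "trec (\<lambda>z. g (p1 z) (p1 (p2 z)) (p2 (p2 z)))"
  shows "trec (\<lambda>x. rec_nat (f x) (g x) (n x))"
proof -
  obtain c d where c: "\<And>x. eval c x = Some (f x)"
    and d: "\<And>z. eval d z = Some (g (p1 z) (p1 (p2 z)) (p2 (p2 z)))"
    using f g unfolding trec_def by metis
  have "eval (PrimRec c d) (pe x k) = Some (rec_nat (f x) (g x) k)" for x k
    by (induction k) (simp_all add: c d)
  then have "trec (\<lambda>z. rec_nat (f (p1 z)) (g (p1 z)) (p2 z))"
    unfolding trec_def by (metis pe_p1_p2)
  from trec_comp[OF this trec_pe[OF trec_id n]] show ?thesis by simp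
qed

lemma trec_add: "trec f \<Longrightarrow> trec g \<Longrightarrow> trec (\<lambda>x. f x + g x)"
proof -
  assume "trec f" "trec g"
  then have "trec (\<lambda>x. rec_nat (f x) (\<lambda>k r. Suc r) (g x))"
    by (intro trec_rec trec_Suc trec_p2 trec_id)
  moreover have "rec_nat a (\<lambda>k. Suc) b = a + b" for a b :: nat
    by (induction b) simp_all
  ultimately show ?thesis by simp
qed

lemma trec_pred: "trec f \<Longrightarrow> trec (\<lambda>x. f x - Suc 0)"
proof -
  assume "trec f"
  then have "trec (\<lambda>x. rec_nat 0 (\<lambda>k r. k) (f x))"
    by (intro trec_rec trec_const trec_p1 trec_p2 trec_id)
  moreover have "rec_nat 0 (\<lambda>k r. k) n = n - Suc 0" for n
    by (cases n) simp_all
  ultimately show ?thesis by simp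
qed

lemma trec_minus: "trec f \<Longrightarrow> trec g \<Longrightarrow> trec (\<lambda>x. f x - g x)"
proof -
  assume "trec f" "trec g"
  then have "trec (\<lambda>x. rec_nat (f x) (\<lambda>k r. r - Suc 0) (g x))"
    by (intro trec_rec trec_pred trec_p2 trec_id)
  moreover have "rec_nat a (\<lambda>k r. r - Suc 0) b = a - b" for a b :: nat
    by (induction b) simp_all
  ultimately show ?thesis by simp
qed

lemma trec_if:
  assumes "trec a" "trec b" "trec f" "trec g"
  shows "trec (\<lambda>x. if a x = b x then f x else g x)"
proof -
  \<comment> \<open>The number of rounds is the symmetric difference, which is \<open>0\<close>
    exactly when the two values agree; any positive number of rounds overwrites \<open>f x\<close>
    by \<open>g x\<close>.\<close>
  have "trec (\<lambda>x. rec_nat (f x) (\<lambda>k r. g x) ((a x - b x) + (b x - a x)))"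
    using assms(4) by (intro trec_rec trec_add trec_minus assms trec_comp[OF assms(4)] trec_p1 trec_id)
  moreover have "rec_nat u (\<lambda>k r. v) ((c - d) + (d - c)) = (if c = d then u else v)"
    for u v c d :: nat
    by (cases "(c - d) + (d - c)") auto
  ultimately show ?thesis by simp
qed

text \<open>The numbering \<open>index\<close> stores the constructor of a composite code in the
  residue modulo 4, so the machine decodes with these two functions. The residue is a counter that
  wraps after 3; the quotient grows each time it wraps.\<close>

lemma trec_mod_div_4: "trec f \<Longrightarrow> trec (\<lambda>x. f x mod 4)" "trec f \<Longrightarrow> trec (\<lambda>x. f x div 4)"
proof -
  have m: "rec_nat 0 (\<lambda>k r. if r = 3 then 0 else Suc r) n = n mod 4" for n :: nat
    by (induction n) (auto simp: mod_Suc)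
  have d: "rec_nat 0 (\<lambda>k r. if k mod 4 = 3 then Suc r else r) n = n div 4" for n :: nat
    by (induction n) (auto simp: div_Suc mod_Suc split: if_splits)
  show *: "trec (\<lambda>x. f x mod 4)" if "trec f" for f
    unfolding m[symmetric]
    by (intro trec_rec trec_if trec_const trec_Suc trec_p2 trec_id that)
  show "trec (\<lambda>x. f x div 4)" if "trec f" for f
    unfolding d[symmetric]
    by (intro trec_rec trec_if * trec_const trec_Suc trec_p1 trec_p2 trec_id that)
qed

lemmas trec_intros = trec_id trec_const trec_Suc trec_p1 trec_p2 trec_pe trec_pred trec_add
  trec_if trec_mod_div_4

section \<open>A universal partial recursive function\<close>

text \<open>
  A stack machine: a state is a pair of a value and a stack of instructions, and an instruction
  \<open>pe 0 e\<close> runs the code \<open>e\<close> on the value. The other instructions are suspended computations: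
  1 and 2 the second component of a pairing, still to be computed resp. being computed, 3 a
  recursion with its counter and the number of rounds left, 4 a minimisation.
\<close>

definition push :: "nat \<Rightarrow> nat \<Rightarrow> nat \<Rightarrow> nat" where
  "push t d R = Suc (pe (pe t d) R)"

text \<open>Codes from 4 on have the form \<open>4 * q + 4 + t\<close> with \<open>t < 4\<close>, so
  \<open>e mod 4\<close> gives the constructor and \<open>e div 4 - Suc 0\<close> the code
  \<open>q\<close> of its arguments.\<close>

definition run_code :: "nat \<Rightarrow> nat \<Rightarrow> nat \<Rightarrow> nat" where
  "run_code e v R =
    (if e = 0 then pe 0 R else if e = 1 then pe (Suc v) R
     else if e = 2 then pe (p1 v) R else if e = 3 then pe (p2 v) R
     else if e mod 4 = 0 then
       pe v (push 0 (p1 (e div 4 - Suc 0)) (push 1 (pe v (p2 (e div 4 - Suc 0))) R))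
     else if e mod 4 = 1 then
       pe v (push 0 (p2 (e div 4 - Suc 0)) (push 0 (p1 (e div 4 - Suc 0)) R))
     else if e mod 4 = 2 then
       pe (p1 v) (push 0 (p1 (e div 4 - Suc 0))
         (push 3 (pe (pe (p2 (e div 4 - Suc 0)) (p1 v)) (pe 0 (p2 v))) R))
     else pe (pe v 0) (push 0 (e div 4 - Suc 0) (push 4 (pe (e div 4 - Suc 0) (pe v 0)) R)))"

text \<open>The data \<open>d\<close> nest as follows: instruction 1 holds the input and the second
  code, 2 the first result, 3 the pair of step code and parameter followed by counter and remaining
  rounds, 4 the code followed by the argument and the current candidate.\<close>

definition resume :: "nat \<Rightarrow> nat \<Rightarrow> nat \<Rightarrow> nat \<Rightarrow> nat" where
  "resume t d v R =
    (if t = 0 then run_code d v R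
     else if t = 1 then pe (p1 d) (push 0 (p2 d) (push 2 v R))
     else if t = 2 then pe (pe d v) R
     else if t = 3 then
       (if p2 (p2 d) = 0 then pe v R
        else pe (pe (p2 (p1 d)) (pe (p1 (p2 d)) v)) (push 0 (p1 (p1 d))
          (push 3 (pe (p1 d) (pe (Suc (p1 (p2 d))) (p2 (p2 d) - Suc 0))) R)))
     else
       (if v = 0 then pe (p2 (p2 d)) R
        else pe (pe (p1 (p2 d)) (Suc (p2 (p2 d)))) (push 0 (p1 d)
          (push 4 (pe (p1 d) (pe (p1 (p2 d)) (Suc (p2 (p2 d))))) R))))"

definition step :: "nat \<Rightarrow> nat" where
  "step s = (if p2 s = 0 then s
     else resume (p1 (p1 (p2 s - Suc 0))) (p2 (p1 (p2 s - Suc 0))) (p1 s) (p2 (p2 s - Suc 0)))"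

lemma trec_push: "trec t \<Longrightarrow> trec d \<Longrightarrow> trec R \<Longrightarrow> trec (\<lambda>x. push (t x) (d x) (R x))"
  unfolding push_def by (intro trec_intros)

lemma trec_step: "trec step"
proof -
  have r: "trec (\<lambda>x. run_code (e x) (v x) (R x))" if "trec e" "trec v" "trec R" for e v R
    unfolding run_code_def by (intro trec_intros trec_push that)
  have s: "trec (\<lambda>x. resume (t x) (d x) (v x) (R x))" if "trec t" "trec d" "trec v" "trec R"
    for t d v R
    unfolding resume_def by (intro trec_intros trec_push r that)
  show ?thesis
    unfolding step_def[abs_def] by (intro trec_intros s)
qed

definition reach :: "nat \<Rightarrow> nat \<Rightarrow> bool" where
  "reach s s' \<longleftrightarrow> (\<exists>n. (step ^^ n) s = s')"

lemma reach_refl: "reach s s"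
  unfolding reach_def by (rule exI[of _ 0]) simp

lemma reach_trans [trans]: "reach a b \<Longrightarrow> reach b c \<Longrightarrow> reach a c"
  unfolding reach_def by (metis funpow_add o_apply)

lemma reach_step: "reach (step s) s' \<Longrightarrow> reach s s'"
  unfolding reach_def by (metis funpow_simps_right(2) o_apply)

lemma step_push: "step (pe v (push t d R)) = resume t d v R"
  by (simp add: step_def push_def)

text \<open>The converse is not needed, because realizers are never applied outside their domain.\<close>

lemma reach_eval: "eval c x = Some v \<Longrightarrow> reach (pe x (push 0 (index c) R)) (pe v R)"
proof (induction c arbitrary: x v R)
  case (Pairing c d)
  then obtain a b where ab: "eval c x = Some a" "eval d x = Some b" "v = pe a b"
    by (auto simp: bind_eq_Some_conv)
  have "reach (pe x (push 0 (index c) (push 1 (pe x (index d)) R))) (pe a (push 1 (pe x (index d)) R))"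
    using Pairing.IH(1) ab by blast
  also have "reach \<dots> (pe x (push 0 (index d) (push 2 a R)))"
    by (rule reach_step) (simp add: step_push resume_def reach_refl)
  also have "reach \<dots> (pe b (push 2 a R))"
    using Pairing.IH(2) ab by blast
  also have "reach \<dots> (pe v R)"
    by (rule reach_step) (simp add: step_push resume_def reach_refl ab)
  finally show ?case
    by - (rule reach_step, simp add: step_push resume_def run_code_def)
next
  case (Comp c d)
  then obtain a where a: "eval d x = Some a" "eval c a = Some v"
    by (auto simp: bind_eq_Some_conv)
  have "reach (pe x (push 0 (index d) (push 0 (index c) R))) (pe a (push 0 (index c) R))"
    using Comp.IH(2) a by blast
  also have "reach \<dots> (pe v R)"
    using Comp.IH(1) a by blast
  finally show ?case
    by - (rule reach_step, simp add: step_push resume_def run_code_def)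
next
  case (PrimRec c d)
  obtain a n where x: "x = pe a n" by (metis pe_p1_p2)
  define f where "f = rec_nat (eval c a)
    (\<lambda>k r. Option.bind r (\<lambda>v. eval d (pe a (pe k v))))"
  have fn: "f n = Some v" using PrimRec.prems by (simp add: x f_def)
  \<comment> \<open>An undefined stage would make all later stages undefined, so the final value
    forces every earlier one.\<close>
  have f_le: "\<exists>w. f k = Some w" if "k \<le> n" for k
    using that fn by (induction rule: inc_induct) (auto simp: f_def bind_eq_Some_conv)
  have loop: "reach (pe w (push 3 (pe (pe (index d) a) (pe k j)) R)) (pe v R)"
    if "k + j = n" "f k = Some w" for j k w
    using that
  proof (induction j arbitrary: k w)
    case 0
    then show ?case
      using fn by - (rule reach_step, simp add: step_push resume_def reach_refl)
  next
    case (Suc j)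
    then obtain w' where w': "f (Suc k) = Some w'" using f_le[of "Suc k"] by auto
    then have "eval d (pe a (pe k w)) = Some w'" using Suc.prems by (simp add: f_def)
    from PrimRec.IH(2)[OF this]
    have "reach (pe (pe a (pe k w)) (push 0 (index d) (push 3 (pe (pe (index d) a) (pe (Suc k) j)) R)))
      (pe w' (push 3 (pe (pe (index d) a) (pe (Suc k) j)) R))" .
    also have "reach \<dots> (pe v R)"
      using Suc.prems w' by (intro Suc.IH) auto
    finally show ?case
      by - (rule reach_step, simp add: step_push resume_def)
  qed
  obtain w where w: "eval c a = Some w" using f_le[of 0] by (auto simp: f_def)
  have "reach (pe a (push 0 (index c) (push 3 (pe (pe (index d) a) (pe 0 n)) R)))
      (pe w (push 3 (pe (pe (index d) a) (pe 0 n)) R))"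
    using PrimRec.IH(1)[OF w] .
  also have "reach \<dots> (pe v R)"
    using w by (intro loop) (auto simp: f_def)
  finally show ?case
    by - (rule reach_step, simp add: step_push resume_def run_code_def x mod_Suc)
next
  case (Mu c)
  let ?P = "\<lambda>n. eval c (pe x n) = Some 0"
  have ex: "\<exists>n. ?P n \<and> (\<forall>k<n. eval c (pe x k) \<noteq> None)" and v: "v = (LEAST n. ?P n)"
    using Mu.prems by (auto split: if_splits)
  then obtain n where n: "?P n" "\<forall>k<n. eval c (pe x k) \<noteq> None" by blast
  have vn: "v \<le> n" "?P v" using v n(1) by (auto intro: Least_le LeastI)
  \<comment> \<open>Below the least zero the search is defined and positive, so the machine goes on
    to the next candidate instead of stopping.\<close>
  have nv: "\<exists>w. eval c (pe x k) = Some (Suc w)" if kv: "k < v" for k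
  proof -
    obtain w where "eval c (pe x k) = Some w" using n(2) kv vn(1) by (meson less_le_trans option.exhaust)
    moreover have "\<not> ?P k" using kv v not_less_Least by blast
    ultimately show ?thesis by (cases w) auto
  qed
  have loop: "reach (pe (pe x k) (push 0 (index c) (push 4 (pe (index c) (pe x k)) R))) (pe v R)"
    if "k \<le> v" for k
    using that
  proof (induction rule: inc_induct)
    case base
    show ?case
      by (rule reach_trans[OF Mu.IH[OF vn(2)]], rule reach_step)
        (simp add: step_push resume_def reach_refl)
  next
    case (step k)
    then obtain w where "eval c (pe x k) = Some (Suc w)" using nv by blast
    from Mu.IH[OF this] have "reach (pe (pe x k) (push 0 (index c) (push 4 (pe (index c) (pe x k)) R)))
        (pe (Suc w) (push 4 (pe (index c) (pe x k)) R))" .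
    also have "reach \<dots> (pe v R)"
      using step.IH by - (rule reach_step, simp add: step_push resume_def)
    finally show ?case .
  qed
  show ?case
    using loop[of 0] by - (rule reach_step, simp add: step_push resume_def run_code_def mod_Suc)
qed (rule reach_step, simp add: step_push resume_def run_code_def reach_refl)+

lemma app_index [simp]: "app (index c) = eval c"
  by (simp add: app_def[abs_def] inv_f_f bij_is_inj bij_index)

text \<open>Halted states are fixed points, so running the machine for too many steps does no
  harm.\<close>

lemma halted: "p2 s = 0 \<Longrightarrow> (step ^^ n) s = s"
  by (induction n) (simp_all add: step_def)

text \<open>The state after a given number of steps is total recursive, since \<open>step\<close>
  is; the only unbounded search is one minimisation for a step count at which the stack is
  empty.\<close>

theorem universal: "\<exists>u. \<forall>e x v. app e x = Some v \<longrightarrow> eval u (pe e x) = Some v"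
proof -
  define conf where "conf z = (step ^^ p2 z) (pe (p2 (p1 z)) (push 0 (p1 (p1 z)) 0))" for z
  have "(step ^^ n) s = rec_nat s (\<lambda>_. step) n" for n s
    by (induction n) simp_all
  then have conf: "trec conf"
    unfolding conf_def
    by (auto intro!: trec_intros trec_push trec_rec trec_comp[OF trec_step])
  have "trec (\<lambda>z. p2 (conf z))" "trec (\<lambda>z. p1 (conf z))" by (intro trec_intros conf)+
  then obtain c d where c: "\<And>z. eval c z = Some (p2 (conf z))"
    and d: "\<And>z. eval d z = Some (p1 (conf z))"
    unfolding trec_def by metis
  \<comment> \<open>\<open>Mu c\<close> finds the step count; it is paired with the input, and
    \<open>d\<close> reads the value off that configuration.\<close>
  define u where "u = Comp d (Pairing (Pairing Left Right) (Mu c))"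
  have "eval u (pe e x) = Some v" if ev: "app e x = Some v" for e x v
  proof -
    have e: "e = index (inv index e)" by (simp add: bij_index bij_is_surj surj_f_inv_f)
    define s where "s n = conf (pe (pe e x) n)" for n
    have s: "s n = (step ^^ n) (pe x (push 0 e 0))" for n
      by (simp add: s_def conf_def)
    have "reach (pe x (push 0 e 0)) (pe v 0)"
      using reach_eval[of "inv index e" x v 0] ev e by (simp add: app_def)
    then obtain n where n: "s n = pe v 0" unfolding reach_def s by blast
    \<comment> \<open>The least halting count \<open>m\<close> may be smaller than \<open>n\<close>;
      both configurations agree because \<open>s m\<close> is already a fixed point.\<close>
    define m where "m = (LEAST n. p2 (s n) = 0)"
    have m: "m \<le> n" "p2 (s m) = 0"
      unfolding m_def using n by (auto intro: Least_le LeastI[of _ n])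
    have "s n = (step ^^ (n - m)) (s m)"
      using m(1) unfolding s by (metis add_diff_inverse_nat add.commute funpow_add not_less o_apply)
    then have "s m = pe v 0" using halted[OF m(2)] n by simp
    moreover have "eval (Mu c) (pe e x) = Some m"
    proof -
      have "\<exists>n. p2 (conf (pe (pe e x) n)) = 0" using m(2) s_def by metis
      then show ?thesis by (simp add: c m_def s_def)
    qed
    ultimately show ?thesis
      by (simp add: u_def d s_def)
  qed
  then show ?thesis by blast
qed

section \<open>Combinatory completeness\<close>

text \<open>The recursion step expresses \<open>index (Comp Succ c)\<close> through
  \<open>index c\<close>. Making it explicit shows that a code of the constant \<open>n\<close> is
  computed from \<open>n\<close>.\<close>

lemma index_const: "\<exists>c. index c = rec_nat 0 (\<lambda>_ r. 4 * pe (index Succ) r + 5) n \<and> (\<forall>x. eval c x = Some n)"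
proof (induction n)
  case 0
  show ?case by (rule exI[of _ Zero]) simp
next
  case (Suc n)
  then obtain c where "index c = rec_nat 0 (\<lambda>_ r. 4 * pe (index Succ) r + 5) n"
    "\<forall>x. eval c x = Some n" by blast
  then show ?case by (intro exI[of _ "Comp Succ c"]) simp
qed

text \<open>The value \<open>ea\<close> codes the composition of \<open>c\<close> with the pairing
  of the constant \<open>a\<close> and the identity, so only its index has to be computed.\<close>

lemma s_m_n: "\<exists>e. \<forall>a. \<exists>ea. app e a = Some ea \<and> (\<forall>b. app ea b = eval c (pe a b))"
proof -
  let ?k = "rec_nat 0 (\<lambda>_ r. 4 * pe (index Succ) r + 5)"
  let ?i = "index (Pairing Left Right)"
  have four: "4 * m = m + m + (m + m)" for m :: nat by simp
  have "trec (\<lambda>a. 4 * pe (index c) (4 * pe (?k a) ?i + 4) + 5)"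
    unfolding four by (intro trec_intros trec_rec)
  then obtain d where d: "eval d a = Some (4 * pe (index c) (4 * pe (?k a) ?i + 4) + 5)" for a
    unfolding trec_def by blast
  have "\<exists>ea. app (index d) a = Some ea \<and> (\<forall>b. app ea b = eval c (pe a b))" for a
  proof -
    obtain ca where ca: "index ca = ?k a" "\<And>x. eval ca x = Some a"
      using index_const by metis
    have "app (index d) a = Some (index (Comp c (Pairing ca (Pairing Left Right))))"
      by (simp add: d ca(1))
    moreover have "app (index (Comp c (Pairing ca (Pairing Left Right)))) b = eval c (pe a b)" for b
      unfolding app_index by (simp add: ca(2))
    ultimately show ?thesis by blast
  qed
  then show ?thesis by blast
qed

lemma ex_combinator_K: "\<exists>k. \<forall>a. \<exists>ka. app k a = Some ka \<and> (\<forall>b. app ka b = Some a)"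
  using s_m_n[of Left] by simp

lemma ex_combinator_P: "\<exists>p. \<forall>a. \<exists>pa. app p a = Some pa \<and> (\<forall>b. app pa b = Some (pe a b))"
  using s_m_n[of "Pairing Left Right"] by simp

lemma ex_combinator_S:
  "\<exists>s. \<forall>a. \<exists>sa. app s a = Some sa \<and> (\<forall>b. \<exists>sab. app sa b = Some sab \<and>
     (\<forall>x f y z. app a x = Some f \<longrightarrow> app b x = Some y \<longrightarrow> app f y = Some z \<longrightarrow> app sab x = Some z))"
proof -
  obtain u where u: "\<And>e x v. app e x = Some v \<Longrightarrow> eval u (pe e x) = Some v"
    using universal by blast
  \<comment> \<open>On input \<open>pe (pe a b) x\<close> this computes \<open>a x\<close> and
    \<open>b x\<close> and applies the former to the latter, each time by the universal
    \<open>u\<close>.\<close>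
  define c where "c = Comp u (Pairing (Comp u (Pairing (Comp Left Left) Right))
    (Comp u (Pairing (Comp Right Left) Right)))"
  have c: "eval c (pe (pe a b) x) = Some z"
    if "app a x = Some f" "app b x = Some y" "app f y = Some z" for a b x f y z
    using that by (simp add: c_def u)
  \<comment> \<open>Currying takes two rounds: \<open>e\<close> absorbs the pair of \<open>a\<close>
    and \<open>b\<close>, and \<open>s\<close> below supplies this pair one argument at a
    time.\<close>
  obtain e h where e: "\<And>a. app e a = Some (h a)" "\<And>a b. app (h a) b = eval c (pe a b)"
    using s_m_n[of c] by metis
  obtain ce where ce: "app e = eval ce" by (auto simp: app_def[abs_def])
  obtain s k where s: "\<And>a. app s a = Some (k a)" "\<And>a b. app (k a) b = eval ce (pe a b)"
    using s_m_n[of ce] by metis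
  have "app (k a) b = Some (h (pe a b))" for a b
    using e(1) s(2) ce by simp
  moreover have "app (h (pe a b)) x = Some z"
    if "app a x = Some f" "app b x = Some y" "app f y = Some z" for a b x f y z
    using c[OF that] e(2) by simp
  ultimately show ?thesis
    using s(1) by blast
qed

definition "comb_K = (SOME k. \<forall>a. \<exists>ka. app k a = Some ka \<and> (\<forall>b. app ka b = Some a))"
definition "comb_P = (SOME p. \<forall>a. \<exists>pa. app p a = Some pa \<and> (\<forall>b. app pa b = Some (pe a b)))"
definition "comb_S = (SOME s. \<forall>a. \<exists>sa. app s a = Some sa \<and> (\<forall>b. \<exists>sab. app sa b = Some sab \<and>
     (\<forall>x f y z. app a x = Some f \<longrightarrow> app b x = Some y \<longrightarrow> app f y = Some z \<longrightarrow> app sab x = Some z)))"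

lemmas comb_K = someI_ex[OF ex_combinator_K, folded comb_K_def]
lemmas comb_P = someI_ex[OF ex_combinator_P, folded comb_P_def]
lemmas comb_S = someI_ex[OF ex_combinator_S, folded comb_S_def]

section \<open>Applicative terms and bracket abstraction\<close>

datatype tm = V string | C nat | Ap tm tm (infixl "\<^bold>\<cdot>" 90)

primrec subst :: "string \<Rightarrow> nat \<Rightarrow> tm \<Rightarrow> tm" where
  "subst x a (V y) = (if y = x then C a else V y)"
| "subst x a (C n) = C n"
| "subst x a (s \<^bold>\<cdot> t) = subst x a s \<^bold>\<cdot> subst x a t"

text \<open>Bracket abstraction. Only constants are ever substituted, so there is no capture.\<close>

primrec lam :: "string \<Rightarrow> tm \<Rightarrow> tm" where
  "lam x (V y) = (if y = x then C comb_S \<^bold>\<cdot> C comb_K \<^bold>\<cdot> C comb_K else C comb_K \<^bold>\<cdot> V y)"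
| "lam x (C n) = C comb_K \<^bold>\<cdot> C n"
| "lam x (s \<^bold>\<cdot> t) = C comb_S \<^bold>\<cdot> lam x s \<^bold>\<cdot> lam x t"

text \<open>Free variables get the junk value \<open>0\<close>, so that abstractions always denote.\<close>

primrec den :: "tm \<Rightarrow> nat option" where
  "den (V y) = Some 0"
| "den (C n) = Some n"
| "den (s \<^bold>\<cdot> t) = Option.bind (den s) (\<lambda>f. Option.bind (den t) (app f))"

lemma subst_lam: "x \<noteq> y \<Longrightarrow> subst x a (lam y t) = lam y (subst x a t)"
  by (induction t) auto

lemma subst_lam_same [simp]: "subst x a (lam x t) = lam x t"
  by (induction t) auto

text \<open>Abstractions denote even when the body does not, because \<open>comb_S\<close> applied
  to two arguments is always defined. The beta rule is one-directional, as \<open>comb_S\<close> is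
  specified only where the computation succeeds.\<close>

lemma den_lam: "\<exists>v. den (lam x t) = Some v \<and> (\<forall>a w. den (subst x a t) = Some w \<longrightarrow> app v a = Some w)"
proof (induction t)
  case (V y)
  obtain k where k: "app comb_K 0 = Some k" "\<And>b. app k b = Some 0"
    using comb_K by blast
  obtain s i where s: "app comb_S comb_K = Some s" "app s comb_K = Some i"
    and i: "\<And>x f y z. app comb_K x = Some f \<Longrightarrow> app comb_K x = Some y \<Longrightarrow> app f y = Some z \<Longrightarrow> app i x = Some z"
    using comb_S by meson
  have "app i a = Some a" for a
    using comb_K[rule_format, of a] i[of a] by blast
  then show ?case using k s by auto
next
  case (C n)
  then show ?case using comb_K[rule_format, of n] by auto
next
  case (Ap s t)
  then obtain f g where fg: "den (lam x s) = Some f" "den (lam x t) = Some g"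
    "\<And>a w. den (subst x a s) = Some w \<Longrightarrow> app f a = Some w"
    "\<And>a w. den (subst x a t) = Some w \<Longrightarrow> app g a = Some w" by blast
  obtain sf sfg where "app comb_S f = Some sf" "app sf g = Some sfg"
    "\<And>x p y z. app f x = Some p \<Longrightarrow> app g x = Some y \<Longrightarrow> app p y = Some z \<Longrightarrow> app sfg x = Some z"
    using comb_S by meson
  then show ?case using fg by (auto simp: bind_eq_Some_conv)
qed

declare lam.simps [simp del]

section \<open>Introduction and elimination rules for realizability\<close>

definition realizes :: "tm \<Rightarrow> nat set \<Rightarrow> bool" (infix "\<tturnstile>" 50) where
  "t \<tturnstile> \<phi> \<longleftrightarrow> (\<exists>a\<in>\<phi>. den t = Some a)"

lemma C_I: "a \<in> \<phi> \<Longrightarrow> C a \<tturnstile> \<phi>"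
  by (simp add: realizes_def)

lemma Ap_I: "s \<tturnstile> A \<^bold>\<longrightarrow> B \<Longrightarrow> t \<tturnstile> A \<Longrightarrow> s \<^bold>\<cdot> t \<tturnstile> B"
  by (fastforce simp: realizes_def rimp_def)

lemma lam_I: "(\<And>a. a \<in> A \<Longrightarrow> subst x a t \<tturnstile> B) \<Longrightarrow> lam x t \<tturnstile> A \<^bold>\<longrightarrow> B"
  using den_lam[of x t] unfolding realizes_def rimp_def by fastforce

definition pair :: "tm \<Rightarrow> tm \<Rightarrow> tm" where "pair s t = C comb_P \<^bold>\<cdot> s \<^bold>\<cdot> t"
definition proj1 :: "tm \<Rightarrow> tm" where "proj1 t = C (index Left) \<^bold>\<cdot> t"
definition proj2 :: "tm \<Rightarrow> tm" where "proj2 t = C (index Right) \<^bold>\<cdot> t"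

lemma pair_I: "s \<tturnstile> A \<Longrightarrow> t \<tturnstile> B \<Longrightarrow> pair s t \<tturnstile> A \<^bold>\<and> B"
proof -
  assume "s \<tturnstile> A" "t \<tturnstile> B"
  then obtain a b where ab: "den s = Some a" "a \<in> A" "den t = Some b" "b \<in> B"
    unfolding realizes_def by blast
  obtain pa where "app comb_P a = Some pa" "app pa b = Some (pe a b)"
    using comb_P by blast
  then have "den (pair s t) = Some (pe a b)" using ab by (simp add: pair_def)
  moreover have "pe a b \<in> A \<^bold>\<and> B" using ab unfolding rconj_def by blast
  ultimately show ?thesis unfolding realizes_def by blast
qed

lemma proj1_I: "t \<tturnstile> A \<^bold>\<and> B \<Longrightarrow> proj1 t \<tturnstile> A"
  unfolding realizes_def proj1_def rconj_def by (auto simp del: index.simps)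

lemma proj2_I: "t \<tturnstile> A \<^bold>\<and> B \<Longrightarrow> proj2 t \<tturnstile> B"
  unfolding realizes_def proj2_def rconj_def by (auto simp del: index.simps)

lemma subst_pairing [simp]:
  "subst x a (pair s t) = pair (subst x a s) (subst x a t)"
  "subst x a (proj1 t) = proj1 (subst x a t)" "subst x a (proj2 t) = proj2 (subst x a t)"
  by (simp_all add: pair_def proj1_def proj2_def)

text \<open>A term has a single denotation, so realizing every member of the family by the same term
  gives one common number.\<close>

lemma INTER_I: "(\<And>x. t \<tturnstile> \<phi> x) \<Longrightarrow> t \<tturnstile> (\<Inter>x. \<phi> x)"
  unfolding realizes_def by (metis INT_I option.inject)

lemma INTER_E: "t \<tturnstile> (\<Inter>x. \<phi> x) \<Longrightarrow> t \<tturnstile> \<phi> x"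
  unfolding realizes_def by fastforce

lemma rall_I: "(\<And>x. t \<tturnstile> ex x \<^bold>\<longrightarrow> \<phi> x) \<Longrightarrow> t \<tturnstile> rall ex \<phi>"
  unfolding rall_def by (rule INTER_I)

lemma rall_E: "t \<tturnstile> rall ex \<phi> \<Longrightarrow> s \<tturnstile> ex x \<Longrightarrow> t \<^bold>\<cdot> s \<tturnstile> \<phi> x"
  unfolding rall_def using INTER_E[of t "\<lambda>x. ex x \<^bold>\<longrightarrow> \<phi> x"] by (blast intro: Ap_I)

lemma rex_I: "s \<tturnstile> ex x \<Longrightarrow> t \<tturnstile> \<phi> x \<Longrightarrow> pair s t \<tturnstile> rex ex \<phi>"
  using pair_I[of s "ex x" t "\<phi> x"] unfolding rex_def realizes_def by blast

lemma rex_E: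
  assumes "t \<tturnstile> rex ex \<phi>"
  obtains x where "proj1 t \<tturnstile> ex x" "proj2 t \<tturnstile> \<phi> x"
proof -
  obtain x where "t \<tturnstile> ex x \<^bold>\<and> \<phi> x"
    using assms by (auto simp: rex_def realizes_def)
  then show thesis using that proj1_I proj2_I by blast
qed

lemma realizes_nonempty: "t \<tturnstile> \<phi> \<Longrightarrow> \<phi> \<noteq> {}"
  unfolding realizes_def by blast

lemma rall_el_I: "(\<And>x. t \<tturnstile> X x x \<^bold>\<longrightarrow> \<phi> x) \<Longrightarrow> t \<tturnstile> rall (el X) \<phi>"
  by (rule rall_I) (simp add: el_def)

lemma rall_el_E: "t \<tturnstile> rall (el X) \<phi> \<Longrightarrow> s \<tturnstile> X x x \<Longrightarrow> t \<^bold>\<cdot> s \<tturnstile> \<phi> x"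
  using rall_E[of t "el X" \<phi> s x] by (simp add: el_def)

lemma rex_el_I: "s \<tturnstile> X x x \<Longrightarrow> t \<tturnstile> \<phi> x \<Longrightarrow> pair s t \<tturnstile> rex (el X) \<phi>"
  using rex_I[of s "el X" x t \<phi>] by (simp add: el_def)

lemma rex_el_E:
  assumes "t \<tturnstile> rex (el X) \<phi>"
  obtains x where "proj1 t \<tturnstile> X x x" "proj2 t \<tturnstile> \<phi> x"
  using rex_E[OF assms] that unfolding el_def by blast

text \<open>A constant is not affected by substitution, so a closed realizer can be used under binders
  without unfolding it.\<close>

definition close :: "tm \<Rightarrow> tm" where "close t = C (the (den t))"

lemma close_I: "t \<tturnstile> \<phi> \<Longrightarrow> close t \<tturnstile> \<phi>"
  by (auto simp: close_def realizes_def)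

lemma subst_close [simp]: "subst x a (close t) = close t"
  by (simp add: close_def)

definition iden :: nat where "iden = index (Pairing Left Right)"

lemma iden: "iden \<in> A \<^bold>\<longrightarrow> A"
  by (simp add: iden_def rimp_def del: index.simps)

section \<open>Realizers extracted from internal structures\<close>

definition "obj_sym c s = proj1 c \<^bold>\<cdot> s"
definition "obj_trans c s t = proj2 c \<^bold>\<cdot> pair s t"

definition "pre_dom p s = proj1 (proj1 (proj2 p) \<^bold>\<cdot> s)"
definition "pre_cod p s = proj2 (proj1 (proj2 p) \<^bold>\<cdot> s)"
definition "pre_ext p s t u = proj1 (proj2 (proj2 p)) \<^bold>\<cdot> pair s (pair t u)"
definition "pre_extl p s t = pre_ext p s t (pre_cod p s)"
definition "pre_extr p s t = pre_ext p s (pre_dom p s) t"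
definition "pre_refl p t = proj1 (proj2 (proj2 (proj2 p))) \<^bold>\<cdot> t"
definition "pre_trans p s t = proj2 (proj2 (proj2 (proj2 p))) \<^bold>\<cdot> pre_dom p s \<^bold>\<cdot> pre_cod p s
  \<^bold>\<cdot> pre_cod p t \<^bold>\<cdot> pair s t"

definition "fun_dom f s = proj1 (proj1 f \<^bold>\<cdot> s)"
definition "fun_cod f s = proj2 (proj1 f \<^bold>\<cdot> s)"
definition "fun_single f s t = proj1 (proj2 (proj2 f)) \<^bold>\<cdot> pair s t"
definition "fun_total f s = proj2 (proj2 (proj2 f)) \<^bold>\<cdot> s"

lemmas realizer_defs = obj_sym_def obj_trans_def pre_dom_def pre_cod_def pre_ext_def pre_extl_def
  pre_extr_def pre_refl_def pre_trans_def fun_dom_def fun_cod_def fun_single_def fun_total_def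

lemma subst_realizers [simp]:
  "subst x a (obj_sym p s) = obj_sym (subst x a p) (subst x a s)"
  "subst x a (obj_trans p s t) = obj_trans (subst x a p) (subst x a s) (subst x a t)"
  "subst x a (pre_dom p s) = pre_dom (subst x a p) (subst x a s)"
  "subst x a (pre_cod p s) = pre_cod (subst x a p) (subst x a s)"
  "subst x a (pre_extl p s t) = pre_extl (subst x a p) (subst x a s) (subst x a t)"
  "subst x a (pre_extr p s t) = pre_extr (subst x a p) (subst x a s) (subst x a t)"
  "subst x a (pre_refl p s) = pre_refl (subst x a p) (subst x a s)"
  "subst x a (pre_trans p s t) = pre_trans (subst x a p) (subst x a s) (subst x a t)"
  "subst x a (fun_dom p s) = fun_dom (subst x a p) (subst x a s)"
  "subst x a (fun_cod p s) = fun_cod (subst x a p) (subst x a s)"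
  "subst x a (fun_single p s t) = fun_single (subst x a p) (subst x a s) (subst x a t)"
  "subst x a (fun_total p s) = fun_total (subst x a p) (subst x a s)"
  by (simp_all add: realizer_defs)

lemma
  assumes "c \<tturnstile> is_object X"
  shows obj_sym: "s \<tturnstile> X x y \<Longrightarrow> obj_sym c s \<tturnstile> X y x"
    and obj_trans: "s \<tturnstile> X x y \<Longrightarrow> t \<tturnstile> X y z \<Longrightarrow> obj_trans c s t \<tturnstile> X x z"
proof -
  have "proj1 c \<tturnstile> X x y \<^bold>\<longrightarrow> X y x" for x y
    using INTER_E[OF INTER_E[OF proj1_I[OF assms[unfolded is_object_def]]]] .
  then show "s \<tturnstile> X x y \<Longrightarrow> obj_sym c s \<tturnstile> X y x"
    unfolding obj_sym_def by (rule Ap_I)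
  have "proj2 c \<tturnstile> (X x y \<^bold>\<and> X y z) \<^bold>\<longrightarrow> X x z" for x y z
    using INTER_E[OF INTER_E[OF INTER_E[OF proj2_I[OF assms[unfolded is_object_def]]]]] .
  then show "s \<tturnstile> X x y \<Longrightarrow> t \<tturnstile> X y z \<Longrightarrow> obj_trans c s t \<tturnstile> X x z"
    unfolding obj_trans_def by (blast intro: Ap_I pair_I)
qed

lemma
  assumes "p \<tturnstile> preord X le"
  shows pre_obj: "proj1 p \<tturnstile> is_object X"
    and pre_dom: "s \<tturnstile> le x y \<Longrightarrow> pre_dom p s \<tturnstile> X x x"
    and pre_cod: "s \<tturnstile> le x y \<Longrightarrow> pre_cod p s \<tturnstile> X y y"
    and pre_extl: "s \<tturnstile> le x y \<Longrightarrow> t \<tturnstile> X x x' \<Longrightarrow> pre_extl p s t \<tturnstile> le x' y"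
    and pre_extr: "s \<tturnstile> le x y \<Longrightarrow> t \<tturnstile> X y y' \<Longrightarrow> pre_extr p s t \<tturnstile> le x y'"
    and pre_refl: "t \<tturnstile> X x x \<Longrightarrow> pre_refl p t \<tturnstile> le x x"
    and pre_trans: "s \<tturnstile> le x y \<Longrightarrow> t \<tturnstile> le y z \<Longrightarrow> pre_trans p s t \<tturnstile> le x z"
proof -
  note p = assms[unfolded preord_def]
  note p2 = proj2_I[OF p]
  note p3 = proj2_I[OF p2]
  note p4 = proj2_I[OF p3]
  show "proj1 p \<tturnstile> is_object X" using proj1_I[OF p] .
  have "proj1 (proj2 p) \<tturnstile> le x y \<^bold>\<longrightarrow> (X x x \<^bold>\<and> X y y)" for x y
    using INTER_E[OF INTER_E[OF proj1_I[OF p2]]] .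
  then have st: "proj1 (proj2 p) \<^bold>\<cdot> s \<tturnstile> X x x \<^bold>\<and> X y y" if "s \<tturnstile> le x y" for s x y
    using that by (blast intro: Ap_I)
  show dom: "s \<tturnstile> le x y \<Longrightarrow> pre_dom p s \<tturnstile> X x x" for s x y
    unfolding pre_dom_def by (rule proj1_I[OF st])
  show cod: "s \<tturnstile> le x y \<Longrightarrow> pre_cod p s \<tturnstile> X y y" for s x y
    unfolding pre_cod_def by (rule proj2_I[OF st])
  have "proj1 (proj2 (proj2 p)) \<tturnstile> (le x y \<^bold>\<and> X x x' \<^bold>\<and> X y y') \<^bold>\<longrightarrow> le x' y'" for x x' y y'
    using INTER_E[OF INTER_E[OF INTER_E[OF INTER_E[OF proj1_I[OF p3]]]]] .
  then have ext: "pre_ext p s t u \<tturnstile> le x' y'"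
    if "s \<tturnstile> le x y" "t \<tturnstile> X x x'" "u \<tturnstile> X y y'" for s t u x y x' y'
    using that unfolding pre_ext_def by (blast intro: Ap_I pair_I)
  show "s \<tturnstile> le x y \<Longrightarrow> t \<tturnstile> X x x' \<Longrightarrow> pre_extl p s t \<tturnstile> le x' y"
    unfolding pre_extl_def by (blast intro: ext cod)
  show "s \<tturnstile> le x y \<Longrightarrow> t \<tturnstile> X y y' \<Longrightarrow> pre_extr p s t \<tturnstile> le x y'"
    unfolding pre_extr_def by (blast intro: ext dom)
  show "t \<tturnstile> X x x \<Longrightarrow> pre_refl p t \<tturnstile> le x x"
    unfolding pre_refl_def by (rule rall_el_E[OF proj1_I[OF p4]])
  show "pre_trans p s t \<tturnstile> le x z" if s: "s \<tturnstile> le x y" and t: "t \<tturnstile> le y z"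
    using Ap_I[OF rall_el_E[OF rall_el_E[OF rall_el_E[OF proj2_I[OF p4] dom[OF s]] cod[OF s]] cod[OF t]]
      pair_I[OF s t]]
    unfolding pre_trans_def .
qed

lemma
  assumes "f \<tturnstile> func X Y F"
  shows fun_dom: "s \<tturnstile> F x y \<Longrightarrow> fun_dom f s \<tturnstile> X x x"
    and fun_cod: "s \<tturnstile> F x y \<Longrightarrow> fun_cod f s \<tturnstile> Y y y"
    and fun_single: "s \<tturnstile> F x y \<Longrightarrow> t \<tturnstile> F x y' \<Longrightarrow> fun_single f s t \<tturnstile> Y y y'"
    and fun_total: "s \<tturnstile> X x x \<Longrightarrow> fun_total f s \<tturnstile> rex (el Y) (F x)"
proof -
  note f = assms[unfolded func_def]
  note f2 = proj2_I[OF f]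
  note f3 = proj2_I[OF f2]
  have "proj1 f \<tturnstile> F x y \<^bold>\<longrightarrow> (X x x \<^bold>\<and> Y y y)" for x y
    using INTER_E[OF INTER_E[OF proj1_I[OF f]]] .
  then have st: "proj1 f \<^bold>\<cdot> s \<tturnstile> X x x \<^bold>\<and> Y y y" if "s \<tturnstile> F x y" for s x y
    using that by (blast intro: Ap_I)
  show "s \<tturnstile> F x y \<Longrightarrow> fun_dom f s \<tturnstile> X x x"
    unfolding fun_dom_def by (rule proj1_I[OF st])
  show "s \<tturnstile> F x y \<Longrightarrow> fun_cod f s \<tturnstile> Y y y"
    unfolding fun_cod_def by (rule proj2_I[OF st])
  have "proj1 (proj2 (proj2 f)) \<tturnstile> (F x y \<^bold>\<and> F x y') \<^bold>\<longrightarrow> Y y y'" for x y y'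
    using INTER_E[OF INTER_E[OF INTER_E[OF proj1_I[OF f3]]]] .
  then show "s \<tturnstile> F x y \<Longrightarrow> t \<tturnstile> F x y' \<Longrightarrow> fun_single f s t \<tturnstile> Y y y'"
    unfolding fun_single_def by (blast intro: Ap_I pair_I)
  show "s \<tturnstile> X x x \<Longrightarrow> fun_total f s \<tturnstile> rex (el Y) (F x)"
    unfolding fun_total_def by (rule rall_el_E[OF proj2_I[OF f3]])
qed

section \<open>Assemblies and graphs of maps out of them\<close>

lemma realizes_assembly: "t \<tturnstile> assembly S ex x y \<longleftrightarrow> x = y \<and> x \<in> S \<and> t \<tturnstile> ex x"
  by (auto simp: assembly_def realizes_def)

lemma realizes_subN: "t \<tturnstile> subN A n m \<longleftrightarrow> n = m \<and> n \<in> A \<and> t \<tturnstile> {n}"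
  by (simp add: subN_def realizes_assembly)

lemma realizes_Mstar_obj: "t \<tturnstile> Mstar_obj f g \<longleftrightarrow> f = g \<and> f \<in> Mstar \<and> t \<tturnstile> E f"
  by (simp add: Mstar_obj_def realizes_assembly)

lemma C_UNIV: "C n \<tturnstile> UNIV"
  by (simp add: C_I)

lemma realizes_nabla: "t \<tturnstile> nabla S x y \<longleftrightarrow> x = y \<and> x \<in> S \<and> t \<tturnstile> UNIV"
  by (simp add: nabla_def realizes_assembly)

definition "graph_fun = close (lam ''o'' (lam ''g'' (pair
    (lam ''s'' (pair (proj1 (V ''s''))
      (obj_trans (V ''o'') (obj_sym (V ''o'') (proj2 (V ''s''))) (proj2 (V ''s'')))))
    (pair
    (lam ''s'' (pair (proj1 (proj2 (V ''s'')))
      (obj_trans (V ''o'') (proj2 (proj1 (V ''s''))) (proj2 (proj2 (V ''s''))))))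
    (pair
    (lam ''s'' (obj_trans (V ''o'') (obj_sym (V ''o'') (proj2 (proj1 (V ''s''))))
       (proj2 (proj2 (V ''s'')))))
    (lam ''s'' (pair (V ''g'' \<^bold>\<cdot> V ''s'') (pair (V ''s'') (V ''g'' \<^bold>\<cdot> V ''s'')))))))))"

lemma subst_graph_fun [simp]: "subst x a graph_fun = graph_fun"
  by (simp add: graph_fun_def)

text \<open>A map of underlying sets becomes an internal function as soon as the existence of
  \<open>g x\<close> is computed from a realizer of \<open>x\<close>: in an assembly only identical
  elements are internally equal, so extensionality in \<open>x\<close> is automatic.\<close>

lemma graph_fun:
  assumes "c' \<tturnstile> is_object Y" "k' \<tturnstile> rall (el (assembly S ex)) (\<lambda>x. Y (g x) (g x))"
  shows "graph_fun \<^bold>\<cdot> c' \<^bold>\<cdot> k' \<tturnstile> func (assembly S ex) Y (graph (assembly S ex) Y g)"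
proof -
  define X where X: "X = assembly S ex"
  have "graph_fun \<tturnstile> is_object Y \<^bold>\<longrightarrow> rall (el X) (\<lambda>x. Y (g x) (g x)) \<^bold>\<longrightarrow> func X Y (graph X Y g)"
    unfolding func_def graph_fun_def
  proof (rule close_I, rule lam_I, simp add: subst_lam, rule lam_I, simp add: subst_lam, intro pair_I INTER_I rall_el_I;
      rule lam_I; simp add: subst_lam)
    fix c k assume c: "c \<in> is_object Y" and k: "k \<in> rall (el X) (\<lambda>x. Y (g x) (g x))"
    note c = C_I[OF c] and k = C_I[OF k]
    have eq: "x = x'" if "t \<tturnstile> X x x'" for t x x'
      using that by (simp add: X realizes_assembly)
    {
      fix x y s assume "s \<in> graph X Y g x y"
      note s = C_I[OF this, unfolded graph_def]
      show "pair (proj1 (C s)) (obj_trans (C c) (obj_sym (C c) (proj2 (C s))) (proj2 (C s))) \<tturnstile> X x x \<^bold>\<and> Y y y"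
        using pair_I[OF proj1_I[OF s] obj_trans[OF c obj_sym[OF c proj2_I[OF s]] proj2_I[OF s]]] .
    next
      fix x x' y y' s assume "s \<in> graph X Y g x y \<^bold>\<and> X x x' \<^bold>\<and> Y y y'"
      note s = C_I[OF this, unfolded graph_def]
      note s1 = proj1_I[OF s] and s2 = proj1_I[OF proj2_I[OF s]] and s3 = proj2_I[OF proj2_I[OF s]]
      show "pair (proj1 (proj2 (C s))) (obj_trans (C c) (proj2 (proj1 (C s))) (proj2 (proj2 (C s)))) \<tturnstile> graph X Y g x' y'"
        using pair_I[OF s2 obj_trans[OF c proj2_I[OF s1] s3]] eq[OF s2] by (simp add: graph_def)
    next
      fix x y y' s assume "s \<in> graph X Y g x y \<^bold>\<and> graph X Y g x y'"
      note s = C_I[OF this, unfolded graph_def]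
      show "obj_trans (C c) (obj_sym (C c) (proj2 (proj1 (C s)))) (proj2 (proj2 (C s))) \<tturnstile> Y y y'"
        using obj_trans[OF c obj_sym[OF c proj2_I[OF proj1_I[OF s]]] proj2_I[OF proj2_I[OF s]]] .
    next
      fix x s assume "s \<in> X x x"
      note s = C_I[OF this]
      show "pair (C k \<^bold>\<cdot> C s) (pair (C s) (C k \<^bold>\<cdot> C s)) \<tturnstile> rex (el Y) (graph X Y g x)"
        unfolding graph_def by (intro rex_el_I[where x = "g x"] pair_I rall_el_E[OF k] s)
    }
  qed
  from Ap_I[OF Ap_I[OF this]] show ?thesis
    using assms unfolding X by blast
qed

section \<open>Joins of families given by functions\<close>

text \<open>A subobject of \<open>N\<close> is projective, since each of its elements has a single realizer. Hence a
  family indexed by it is represented by a function \<open>g\<close> of the underlying sets.\<close>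

definition represents ::
  "('y \<Rightarrow> 'y \<Rightarrow> nat set) \<Rightarrow> nat set \<Rightarrow> (nat \<Rightarrow> 'y \<Rightarrow> nat set) \<Rightarrow> (nat \<Rightarrow> 'y) \<Rightarrow> nat set" where
  "represents Y A \<phi> g = (rall (el (subN A)) (\<lambda>n. \<phi> n (g n)) \<^bold>\<and> (\<Inter>n y. (\<phi> n y \<^bold>\<longrightarrow> Y (g n) y)))"

text \<open>Upper bounds and joins of the function \<open>g\<close>. Compared with
  \<open>upper_bound\<close> and \<open>is_join\<close>, the quantifier over the values of a
  relation disappears.\<close>

definition bound ::
  "('y \<Rightarrow> 'y \<Rightarrow> nat set) \<Rightarrow> nat set \<Rightarrow> (nat \<Rightarrow> 'y) \<Rightarrow> 'y \<Rightarrow> nat set" where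
  "bound le A g z = rall (el (subN A)) (\<lambda>n. le (g n) z)"

definition sup_of ::
  "('y \<Rightarrow> 'y \<Rightarrow> nat set) \<Rightarrow> ('y \<Rightarrow> 'y \<Rightarrow> nat set) \<Rightarrow> nat set \<Rightarrow> (nat \<Rightarrow> 'y) \<Rightarrow> 'y \<Rightarrow> nat set" where
  "sup_of Y le A g z = (bound le A g z \<^bold>\<and> rall (el Y) (\<lambda>w. bound le A g w \<^bold>\<longrightarrow> le z w))"

lemma
  assumes "q \<tturnstile> represents Y A \<phi> g"
  shows represents_at: "s \<tturnstile> subN A n n \<Longrightarrow> proj1 q \<^bold>\<cdot> s \<tturnstile> \<phi> n (g n)"
    and represents_eq: "s \<tturnstile> \<phi> n y \<Longrightarrow> proj2 q \<^bold>\<cdot> s \<tturnstile> Y (g n) y"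
proof -
  note q = assms[unfolded represents_def]
  show "s \<tturnstile> subN A n n \<Longrightarrow> proj1 q \<^bold>\<cdot> s \<tturnstile> \<phi> n (g n)"
    by (rule rall_el_E[OF proj1_I[OF q]])
  have "proj2 q \<tturnstile> \<phi> n y \<^bold>\<longrightarrow> Y (g n) y" using INTER_E[OF INTER_E[OF proj2_I[OF q]]] .
  then show "s \<tturnstile> \<phi> n y \<Longrightarrow> proj2 q \<^bold>\<cdot> s \<tturnstile> Y (g n) y" by (rule Ap_I)
qed

lemma boundD: "u \<tturnstile> bound le A g z \<Longrightarrow> s \<tturnstile> subN A n n \<Longrightarrow> u \<^bold>\<cdot> s \<tturnstile> le (g n) z"
  unfolding bound_def by (rule rall_el_E)

lemma upper_boundD:
  assumes "u \<tturnstile> upper_bound Y le A \<phi> z" "s \<tturnstile> subN A n n" "t \<tturnstile> Y y y" "r \<tturnstile> \<phi> n y"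
  shows "u \<^bold>\<cdot> s \<^bold>\<cdot> t \<^bold>\<cdot> r \<tturnstile> le y z"
  using Ap_I[OF rall_el_E[OF rall_el_E[OF assms(1)[unfolded upper_bound_def] assms(2)] assms(3)] assms(4)] .

lemma sup_of_least:
  assumes "j \<tturnstile> sup_of Y le A g z" "s \<tturnstile> Y w w" "u \<tturnstile> bound le A g w"
  shows "proj2 j \<^bold>\<cdot> s \<^bold>\<cdot> u \<tturnstile> le z w"
  using Ap_I[OF rall_el_E[OF proj2_I[OF assms(1)[unfolded sup_of_def]] assms(2)] assms(3)] .

lemma sup_of_bound: "j \<tturnstile> sup_of Y le A g z \<Longrightarrow> s \<tturnstile> subN A n n \<Longrightarrow> proj1 j \<^bold>\<cdot> s \<tturnstile> le (g n) z"
  unfolding sup_of_def by (rule boundD[OF proj1_I])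

lemma is_join_least:
  assumes "j \<tturnstile> is_join Y le A \<phi> z" "s \<tturnstile> Y w w" "u \<tturnstile> upper_bound Y le A \<phi> w"
  shows "proj2 j \<^bold>\<cdot> s \<^bold>\<cdot> u \<tturnstile> le z w"
  using Ap_I[OF rall_el_E[OF proj2_I[OF assms(1)[unfolded is_join_def]] assms(2)] assms(3)] .

definition "represent = close (lam ''f'' (pair
  (lam ''n'' (proj2 (fun_total (V ''f'') (V ''n''))))
  (lam ''s'' (fun_single (V ''f'')
     (proj2 (fun_total (V ''f'') (fun_dom (V ''f'') (V ''s'')))) (V ''s'')))))"

text \<open>The number \<open>n\<close> is its own only realizer in \<open>subN A\<close>, so
  totality applied to it yields one number, and some value realized by it can be picked. The picked
  \<open>g\<close> depends on \<open>f\<close>, which is therefore fixed first.\<close>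

lemma represent:
  assumes f: "f \<in> func (subN A) Y \<phi>"
  shows "\<exists>g. represent \<^bold>\<cdot> C f \<tturnstile> represents Y A \<phi> g"
proof -
  have "\<exists>y. n \<in> A \<longrightarrow> proj2 (fun_total (C f) (C n)) \<tturnstile> \<phi> n y" for n
    using rex_el_E[OF fun_total[OF C_I[OF f], of "C n" n]]
    by (metis C_I insertI1 realizes_subN)
  then obtain g where g: "\<And>n. n \<in> A \<Longrightarrow> proj2 (fun_total (C f) (C n)) \<tturnstile> \<phi> n (g n)"
    by metis
  \<comment> \<open>\<open>s\<close> denotes \<open>n\<close> itself, so the two terms have the same
    denotation.\<close>
  have g': "proj2 (fun_total (C f) s) \<tturnstile> \<phi> n (g n)" if "s \<tturnstile> subN A n n" for s n
  proof -
    have "n \<in> A" "den s = Some n" using that[unfolded realizes_subN] by (simp_all add: realizes_def)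
    then show ?thesis
      using g[of n] by (simp add: realizes_def fun_total_def proj2_def)
  qed
  \<comment> \<open>The singleton turns the fixed number \<open>f\<close> into a hypothesis, so that
    the abstraction rule applies.\<close>
  have "represent \<tturnstile> {f} \<^bold>\<longrightarrow> represents Y A \<phi> g"
    unfolding represent_def represents_def
  proof (rule close_I, rule lam_I, simp add: subst_lam, intro pair_I INTER_I rall_el_I;
      rule lam_I; simp add: subst_lam)
    fix n s assume "s \<in> subN A n n"
    from g'[OF C_I[OF this]] show "proj2 (fun_total (C f) (C s)) \<tturnstile> \<phi> n (g n)" .
  next
    fix n y s assume "s \<in> \<phi> n y"
    note s = C_I[OF this]
    show "fun_single (C f) (proj2 (fun_total (C f) (fun_dom (C f) (C s)))) (C s) \<tturnstile> Y (g n) y"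
      using fun_single[OF C_I[OF f] g'[OF fun_dom[OF C_I[OF f] s]] s] .
  qed
  then show ?thesis
    using Ap_I C_I by blast
qed

definition "bound_upper = close (lam ''p'' (lam ''q'' (lam ''u'' (lam ''n'' (lam ''y'' (lam ''r''
  (pre_extl (V ''p'') (V ''u'' \<^bold>\<cdot> V ''n'') (proj2 (V ''q'') \<^bold>\<cdot> V ''r''))))))))"

lemma bound_upper:
  "bound_upper \<tturnstile> preord Y le \<^bold>\<longrightarrow> represents Y A \<phi> g \<^bold>\<longrightarrow> bound le A g w \<^bold>\<longrightarrow> upper_bound Y le A \<phi> w"
  unfolding bound_upper_def upper_bound_def
proof (rule close_I, ((rule rall_el_I)?, rule lam_I, simp add: subst_lam)+)
  fix p q u n n' y y' r
  assume "p \<in> preord Y le" "q \<in> represents Y A \<phi> g" "u \<in> bound le A g w" "n' \<in> subN A n n"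
    "y' \<in> Y y y" "r \<in> \<phi> n y"
  note * = this[THEN C_I]
  show "pre_extl (C p) (C u \<^bold>\<cdot> C n') (proj2 (C q) \<^bold>\<cdot> C r) \<tturnstile> le y w"
    using pre_extl[OF *(1) boundD[OF *(3,4)] represents_eq[OF *(2,6)]] .
qed

definition "upper_bound_at = close (lam ''q'' (lam ''u'' (lam ''n''
  (V ''u'' \<^bold>\<cdot> V ''n'' \<^bold>\<cdot> (proj2 (V ''q'') \<^bold>\<cdot> (proj1 (V ''q'') \<^bold>\<cdot> V ''n'')) \<^bold>\<cdot> (proj1 (V ''q'') \<^bold>\<cdot> V ''n'')))))"

lemma upper_bound_at:
  "upper_bound_at \<tturnstile> represents Y A \<phi> g \<^bold>\<longrightarrow> upper_bound Y le A \<phi> w \<^bold>\<longrightarrow> bound le A g w"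
  unfolding upper_bound_at_def bound_def
proof (rule close_I, ((rule rall_el_I)?, rule lam_I, simp add: subst_lam)+)
  fix q u n n'
  assume "q \<in> represents Y A \<phi> g" "u \<in> upper_bound Y le A \<phi> w" "n' \<in> subN A n n"
  note * = this[THEN C_I]
  note s = represents_at[OF *(1,3)]
  show "C u \<^bold>\<cdot> C n' \<^bold>\<cdot> (proj2 (C q) \<^bold>\<cdot> (proj1 (C q) \<^bold>\<cdot> C n')) \<^bold>\<cdot> (proj1 (C q) \<^bold>\<cdot> C n') \<tturnstile> le (g n) w"
    using upper_boundD[OF *(2,3) represents_eq[OF *(1) s] s] .
qed

lemma subst_bounds [simp]:
  "subst x a bound_upper = bound_upper" "subst x a upper_bound_at = upper_bound_at"
  "subst x a represent = represent"
  by (simp_all add: bound_upper_def upper_bound_at_def represent_def)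

definition "sup_of_join = close (lam ''p'' (lam ''q'' (lam ''j'' (pair
  (upper_bound_at \<^bold>\<cdot> V ''q'' \<^bold>\<cdot> proj1 (V ''j''))
  (lam ''w'' (lam ''u'' (proj2 (V ''j'') \<^bold>\<cdot> V ''w'' \<^bold>\<cdot> (bound_upper \<^bold>\<cdot> V ''p'' \<^bold>\<cdot> V ''q'' \<^bold>\<cdot> V ''u''))))))))"

lemma sup_of_join:
  "sup_of_join \<tturnstile> preord Y le \<^bold>\<longrightarrow> represents Y A \<phi> g \<^bold>\<longrightarrow> is_join Y le A \<phi> z \<^bold>\<longrightarrow> sup_of Y le A g z"
  unfolding sup_of_join_def sup_of_def
proof (rule close_I, ((rule rall_el_I)?, rule lam_I, simp add: subst_lam)+, rule pair_I;
    (((rule rall_el_I)?, rule lam_I, simp add: subst_lam)+)?)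
  fix p q j assume pqj: "p \<in> preord Y le" "q \<in> represents Y A \<phi> g" "j \<in> is_join Y le A \<phi> z"
  note * = this[THEN C_I]
  show "upper_bound_at \<^bold>\<cdot> C q \<^bold>\<cdot> proj1 (C j) \<tturnstile> bound le A g z"
    using Ap_I[OF Ap_I[OF upper_bound_at *(2)] proj1_I[OF *(3)[unfolded is_join_def]]] .
  fix w w' u assume wu: "w' \<in> Y w w" "u \<in> bound le A g w"
  show "proj2 (C j) \<^bold>\<cdot> C w' \<^bold>\<cdot> (bound_upper \<^bold>\<cdot> C p \<^bold>\<cdot> C q \<^bold>\<cdot> C u) \<tturnstile> le z w"
    using is_join_least[OF *(3) C_I[OF wu(1)] Ap_I[OF Ap_I[OF Ap_I[OF bound_upper *(1)] *(2)] C_I[OF wu(2)]]] .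
qed

definition "join_of_sup = close (lam ''p'' (lam ''q'' (lam ''j'' (pair
  (bound_upper \<^bold>\<cdot> V ''p'' \<^bold>\<cdot> V ''q'' \<^bold>\<cdot> proj1 (V ''j''))
  (lam ''w'' (lam ''u'' (proj2 (V ''j'') \<^bold>\<cdot> V ''w'' \<^bold>\<cdot> (upper_bound_at \<^bold>\<cdot> V ''q'' \<^bold>\<cdot> V ''u''))))))))"

lemma join_of_sup:
  "join_of_sup \<tturnstile> preord Y le \<^bold>\<longrightarrow> represents Y A \<phi> g \<^bold>\<longrightarrow> sup_of Y le A g z \<^bold>\<longrightarrow> is_join Y le A \<phi> z"
  unfolding join_of_sup_def is_join_def
proof (rule close_I, ((rule rall_el_I)?, rule lam_I, simp add: subst_lam)+, rule pair_I;
    (((rule rall_el_I)?, rule lam_I, simp add: subst_lam)+)?)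
  fix p q j assume pqj: "p \<in> preord Y le" "q \<in> represents Y A \<phi> g" "j \<in> sup_of Y le A g z"
  note * = this[THEN C_I]
  show "bound_upper \<^bold>\<cdot> C p \<^bold>\<cdot> C q \<^bold>\<cdot> proj1 (C j) \<tturnstile> upper_bound Y le A \<phi> z"
    using Ap_I[OF Ap_I[OF Ap_I[OF bound_upper *(1)] *(2)] proj1_I[OF *(3)[unfolded sup_of_def]]] .
  fix w w' u assume wu: "w' \<in> Y w w" "u \<in> upper_bound Y le A \<phi> w"
  show "proj2 (C j) \<^bold>\<cdot> C w' \<^bold>\<cdot> (upper_bound_at \<^bold>\<cdot> C q \<^bold>\<cdot> C u) \<tturnstile> le z w"
    using sup_of_least[OF *(3) C_I[OF wu(1)] Ap_I[OF Ap_I[OF upper_bound_at *(2)] C_I[OF wu(2)]]] .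
qed

definition "represent_graph = close (lam ''k'' (pair
  (lam ''n'' (pair (V ''n'') (V ''k'' \<^bold>\<cdot> V ''n''))) (lam ''s'' (proj2 (V ''s'')))))"

lemma represent_graph:
  "represent_graph \<tturnstile> rall (el (subN A)) (\<lambda>n. Y (g n) (g n)) \<^bold>\<longrightarrow> represents Y A (graph (subN A) Y g) g"
  unfolding represent_graph_def represents_def graph_def
proof (rule close_I, (rule lam_I, simp add: subst_lam)+, rule pair_I;
    (intro INTER_I rall_el_I)?, rule lam_I, simp add: subst_lam)
  fix k n n' assume "k \<in> rall (el (subN A)) (\<lambda>n. Y (g n) (g n))" "n' \<in> subN A n n"
  note * = this[THEN C_I]
  show "pair (C n') (C k \<^bold>\<cdot> C n') \<tturnstile> subN A n n \<^bold>\<and> Y (g n) (g n)"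
    by (intro pair_I *(2) rall_el_E[OF *])
next
  fix n y s assume "s \<in> subN A n n \<^bold>\<and> Y (g n) y"
  from proj2_I[OF C_I[OF this]] show "proj2 (C s) \<tturnstile> Y (g n) y" .
qed

lemma subst_joins [simp]:
  "subst x a sup_of_join = sup_of_join" "subst x a join_of_sup = join_of_sup"
  "subst x a represent_graph = represent_graph"
  by (simp_all add: sup_of_join_def join_of_sup_def represent_graph_def)

section \<open>The two preorders\<close>

text \<open>As \<open>\<A>\<close> is nonempty, some instance of the last premise shows that
  \<open>t\<close> denotes; the number is then the same for all \<open>A\<close>.\<close>

lemma PP_le_I:
  assumes "\<A> \<noteq> {}" "\<B> \<noteq> {}" "\<And>A. A \<in> \<A> \<Longrightarrow> \<exists>B\<in>\<B>. t \<tturnstile> B \<^bold>\<longrightarrow> A"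
  shows "t \<tturnstile> PP_le \<A> \<B>"
proof -
  obtain k where k: "den t = Some k" using assms(1,3) by (auto simp: realizes_def)
  then have "k \<in> PP_le \<A> \<B>" using assms by (auto simp: PP_le_def realizes_def)
  then show ?thesis using k by (auto simp: realizes_def)
qed

lemma PP_le_D:
  assumes "t \<tturnstile> PP_le \<A> \<B>"
  shows "\<A> \<noteq> {}" "\<B> \<noteq> {}" "A \<in> \<A> \<Longrightarrow> \<exists>B\<in>\<B>. t \<tturnstile> B \<^bold>\<longrightarrow> A"
  using assms unfolding realizes_def PP_le_def by (auto split: if_splits)

lemma PP_le_subset: "\<A> \<noteq> {} \<Longrightarrow> \<A> \<subseteq> \<B> \<Longrightarrow> C iden \<tturnstile> PP_le \<A> \<B>"
  by (intro PP_le_I) (auto intro: C_I iden)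

lemma realizes_PP_obj: "t \<tturnstile> PP_obj \<A> \<B> \<longleftrightarrow> \<A> = \<B> \<and> \<A> \<noteq> {} \<and> t \<tturnstile> UNIV"
  unfolding PP_obj_def realizes_nabla by simp

lemma E_D: "e \<tturnstile> E f \<Longrightarrow> k \<tturnstile> p \<^bold>\<longrightarrow> q \<Longrightarrow> s \<tturnstile> f p \<Longrightarrow> e \<^bold>\<cdot> k \<^bold>\<cdot> s \<tturnstile> f q"
  unfolding E_def by (drule INTER_E[of _ _ p], drule INTER_E[of _ _ q]) (intro Ap_I)

lemma Mstar_I: "e \<tturnstile> E f \<Longrightarrow> s \<tturnstile> f p \<Longrightarrow> f \<in> Mstar"
  unfolding Mstar_def M_def by (auto dest: realizes_nonempty)

lemma Mstar_le_I:
  assumes "f \<in> Mstar" "g \<in> Mstar" "s \<tturnstile> E f" "t \<tturnstile> E g" "\<And>p. u \<tturnstile> f p \<^bold>\<longrightarrow> g p"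
  shows "pair s (pair t u) \<tturnstile> Mstar_le f g"
  unfolding Mstar_le_def using assms by (simp add: pair_I INTER_I)

lemma Mstar_le_D:
  assumes "t \<tturnstile> Mstar_le f g"
  shows "f \<in> Mstar" "g \<in> Mstar" "proj1 t \<tturnstile> E f" "proj1 (proj2 t) \<tturnstile> E g" "proj2 (proj2 t) \<tturnstile> f p \<^bold>\<longrightarrow> g p"
proof -
  have *: "f \<in> Mstar" "g \<in> Mstar" "t \<tturnstile> E f \<^bold>\<and> E g \<^bold>\<and> (\<Inter>p. (f p \<^bold>\<longrightarrow> g p))"
    using assms unfolding Mstar_le_def by (auto split: if_splits dest: realizes_nonempty)
  then show "f \<in> Mstar" "g \<in> Mstar" by simp_all
  show "proj1 t \<tturnstile> E f" "proj1 (proj2 t) \<tturnstile> E g"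
    using proj1_I[OF *(3)] proj1_I[OF proj2_I[OF *(3)]] .
  show "proj2 (proj2 t) \<tturnstile> f p \<^bold>\<longrightarrow> g p"
    using INTER_E[OF proj2_I[OF proj2_I[OF *(3)]]] .
qed

definition "assembly_obj = close (pair (lam ''s'' (V ''s'')) (lam ''s'' (proj1 (V ''s''))))"

lemma assembly_obj: "assembly_obj \<tturnstile> is_object (assembly S ex)"
  unfolding assembly_obj_def is_object_def
proof (rule close_I, rule pair_I; intro INTER_I; rule lam_I; simp)
  fix x y s assume "s \<in> assembly S ex x y"
  note * = this[THEN C_I]
  then show "C s \<tturnstile> assembly S ex y x" by (auto simp: realizes_assembly)
next
  fix x y z s assume "s \<in> assembly S ex x y \<^bold>\<and> assembly S ex y z"
  note * = this[THEN C_I]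
  show "proj1 (C s) \<tturnstile> assembly S ex x z"
    using proj1_I[OF *] proj2_I[OF *] by (auto simp: realizes_assembly)
qed

definition "PP_pre = close (pair assembly_obj (pair (lam ''s'' (pair (C 0) (C 0)))
  (pair (lam ''s'' (proj1 (V ''s''))) (pair (lam ''x'' (C iden))
    (lam ''x'' (lam ''y'' (lam ''z'' (lam ''s'' (lam ''m''
      (proj1 (V ''s'') \<^bold>\<cdot> (proj2 (V ''s'') \<^bold>\<cdot> V ''m'')))))))))))"

lemma PP_pre: "PP_pre \<tturnstile> preord PP_obj PP_le"
  unfolding PP_pre_def preord_def
proof (rule close_I, intro pair_I INTER_I; ((rule rall_el_I)?, rule lam_I, simp add: subst_lam)?;
    ((rule rall_el_I)?, rule lam_I, simp add: subst_lam)?; ((rule rall_el_I)?, rule lam_I, simp add: subst_lam)?;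
    (rule lam_I, simp add: subst_lam)?)
  show "assembly_obj \<tturnstile> is_object PP_obj"
    unfolding PP_obj_def nabla_def by (rule assembly_obj)
next
  fix x y s assume "s \<in> PP_le x y"
  note * = PP_le_D[OF C_I[OF this]]
  \<comment> \<open>Every number realizes the existence of a nonempty family, so \<open>0\<close>
    serves.\<close>
  show "pair (C 0) (C 0) \<tturnstile> PP_obj x x \<^bold>\<and> PP_obj y y"
    using * by (intro pair_I) (auto simp: realizes_PP_obj C_UNIV)
next
  fix x x' y y' s assume "s \<in> PP_le x y \<^bold>\<and> PP_obj x x' \<^bold>\<and> PP_obj y y'"
  note * = C_I[OF this]
  show "proj1 (C s) \<tturnstile> PP_le x' y'"
    using proj1_I[OF *] proj1_I[OF proj2_I[OF *]] proj2_I[OF proj2_I[OF *]]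
    by (auto simp: realizes_PP_obj)
next
  fix x s assume "s \<in> PP_obj x x"
  from C_I[OF this] show "C iden \<tturnstile> PP_le x x"
    by (intro PP_le_subset) (auto simp: realizes_PP_obj)
next
  fix x y z s assume "s \<in> PP_le x y \<^bold>\<and> PP_le y z"
  note * = C_I[OF this]
  note s = PP_le_D[OF proj1_I[OF *]] PP_le_D[OF proj2_I[OF *]]
  show "lam ''m'' (proj1 (C s) \<^bold>\<cdot> (proj2 (C s) \<^bold>\<cdot> V ''m'')) \<tturnstile> PP_le x z"
  proof (rule PP_le_I[OF s(1,5)])
    fix A assume "A \<in> x"
    then obtain B D where "B \<in> y" "D \<in> z" and BD: "proj1 (C s) \<tturnstile> B \<^bold>\<longrightarrow> A" "proj2 (C s) \<tturnstile> D \<^bold>\<longrightarrow> B"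
      using s(3,6) by blast
    moreover have "lam ''m'' (proj1 (C s) \<^bold>\<cdot> (proj2 (C s) \<^bold>\<cdot> V ''m'')) \<tturnstile> D \<^bold>\<longrightarrow> A"
      by (rule lam_I, simp) (intro Ap_I[OF BD(1)] Ap_I[OF BD(2)] C_I)
    ultimately show "\<exists>D\<in>z. lam ''m'' (proj1 (C s) \<^bold>\<cdot> (proj2 (C s) \<^bold>\<cdot> V ''m'')) \<tturnstile> D \<^bold>\<longrightarrow> A"
      by blast
  qed
qed

definition "Mstar_pre = close (pair assembly_obj (pair
  (lam ''s'' (pair (proj1 (V ''s'')) (proj1 (proj2 (V ''s'')))))
  (pair (lam ''s'' (proj1 (V ''s''))) (pair (lam ''x'' (pair (V ''x'') (pair (V ''x'') (C iden))))
    (lam ''x'' (lam ''y'' (lam ''z'' (lam ''s'' (pair (proj1 (proj1 (V ''s'')))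
      (pair (proj1 (proj2 (proj2 (V ''s'')))) (lam ''m''
      (proj2 (proj2 (proj2 (V ''s''))) \<^bold>\<cdot> (proj2 (proj2 (proj1 (V ''s''))) \<^bold>\<cdot> V ''m'')))))))))))))"

lemma Mstar_pre: "Mstar_pre \<tturnstile> preord Mstar_obj Mstar_le"
  unfolding Mstar_pre_def preord_def
proof (rule close_I, rule pair_I[OF _ pair_I[OF _ pair_I[OF _ pair_I]]]; (intro INTER_I)?;
    ((rule rall_el_I)?, rule lam_I, simp add: subst_lam)?;
    ((rule rall_el_I)?, rule lam_I, simp add: subst_lam)?; ((rule rall_el_I)?, rule lam_I, simp add: subst_lam)?;
    (rule lam_I, simp add: subst_lam)?)
  show "assembly_obj \<tturnstile> is_object Mstar_obj"
    unfolding Mstar_obj_def by (rule assembly_obj)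
next
  fix f g s assume "s \<in> Mstar_le f g"
  note * = Mstar_le_D[OF C_I[OF this]]
  show "pair (proj1 (C s)) (proj1 (proj2 (C s))) \<tturnstile> Mstar_obj f f \<^bold>\<and> Mstar_obj g g"
    using * by (intro pair_I) (auto simp: realizes_Mstar_obj)
next
  fix f f' g g' s assume "s \<in> Mstar_le f g \<^bold>\<and> Mstar_obj f f' \<^bold>\<and> Mstar_obj g g'"
  note * = C_I[OF this]
  show "proj1 (C s) \<tturnstile> Mstar_le f' g'"
    using proj1_I[OF *] proj1_I[OF proj2_I[OF *]] proj2_I[OF proj2_I[OF *]]
    by (auto simp: realizes_Mstar_obj)
next
  fix f s assume "s \<in> Mstar_obj f f"
  from C_I[OF this] show "pair (C s) (pair (C s) (C iden)) \<tturnstile> Mstar_le f f"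
    by (intro Mstar_le_I C_I[OF iden]) (auto simp: realizes_Mstar_obj)
next
  fix f g h s assume "s \<in> Mstar_le f g \<^bold>\<and> Mstar_le g h"
  note * = C_I[OF this]
  note fg = Mstar_le_D[OF proj1_I[OF *]] and gh = Mstar_le_D[OF proj2_I[OF *]]
  show "pair (proj1 (proj1 (C s))) (pair (proj1 (proj2 (proj2 (C s)))) (lam ''m''
      (proj2 (proj2 (proj2 (C s))) \<^bold>\<cdot> (proj2 (proj2 (proj1 (C s))) \<^bold>\<cdot> V ''m'')))) \<tturnstile> Mstar_le f h"
    by (intro Mstar_le_I fg(1) fg(3) gh(2) gh(4), rule lam_I, simp)
      (intro Ap_I[OF gh(5)] Ap_I[OF fg(5)] C_I)
qed

section \<open>The map \<open>G\<close> and its monotonicity\<close>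

definition "E_G = close (lam ''k'' (lam ''e'' (lam ''m'' (V ''k'' \<^bold>\<cdot> (V ''e'' \<^bold>\<cdot> V ''m'')))))"

text \<open>Postcomposition with \<open>k\<close> keeps the same \<open>A\<close>, so one realizer
  serves all \<open>\<A>\<close>.\<close>

lemma E_G: "E_G \<tturnstile> E (G \<A>)"
  unfolding E_G_def E_def
proof (rule close_I, intro INTER_I, (rule lam_I, simp add: subst_lam)+)
  fix p q k e assume "k \<in> p \<^bold>\<longrightarrow> q" "e \<in> G \<A> p"
  then obtain A where A: "A \<in> \<A>" and k: "C k \<tturnstile> p \<^bold>\<longrightarrow> q" and e: "C e \<tturnstile> A \<^bold>\<longrightarrow> p"
    by (auto simp: G_def intro: C_I)
  have "lam ''m'' (C k \<^bold>\<cdot> (C e \<^bold>\<cdot> V ''m'')) \<tturnstile> A \<^bold>\<longrightarrow> q"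
    by (rule lam_I, simp) (intro Ap_I[OF k] Ap_I[OF e] C_I)
  then show "lam ''m'' (C k \<^bold>\<cdot> (C e \<^bold>\<cdot> V ''m'')) \<tturnstile> G \<A> q"
    using A by (auto simp: realizes_def G_def)
qed

lemma G_iden: "A \<in> \<A> \<Longrightarrow> iden \<in> G \<A> A"
  unfolding G_def using iden by blast

lemma G_Mstar: "\<A> \<noteq> {} \<Longrightarrow> G \<A> \<in> Mstar"
  using Mstar_I[OF E_G C_I[OF G_iden]] by blast

lemma E_G_Mstar: "\<A> \<noteq> {} \<Longrightarrow> E_G \<tturnstile> Mstar_obj (G \<A>) (G \<A>)"
  by (simp add: realizes_Mstar_obj G_Mstar E_G)

lemma subst_pre [simp]:
  "subst x a PP_pre = PP_pre" "subst x a Mstar_pre = Mstar_pre" "subst x a E_G = E_G"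
  "subst x a assembly_obj = assembly_obj"
  by (simp_all add: PP_pre_def Mstar_pre_def E_G_def assembly_obj_def)

lemma G_func:
  "graph_fun \<^bold>\<cdot> assembly_obj \<^bold>\<cdot> lam ''s'' E_G \<tturnstile> func PP_obj Mstar_obj (graph PP_obj Mstar_obj G)"
  unfolding PP_obj_def nabla_def
proof (rule graph_fun)
  show "assembly_obj \<tturnstile> is_object Mstar_obj"
    unfolding Mstar_obj_def by (rule assembly_obj)
  show "lam ''s'' E_G \<tturnstile> rall (el (assembly {\<A> :: nat set set. \<A> \<noteq> {}} (\<lambda>_. UNIV))) (\<lambda>\<A>. Mstar_obj (G \<A>) (G \<A>))"
  proof (rule rall_el_I, rule lam_I, simp)
    fix \<A> :: "nat set set" and s assume "s \<in> assembly {\<A> :: nat set set. \<A> \<noteq> {}} (\<lambda>_. UNIV) \<A> \<A>"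
    then show "E_G \<tturnstile> Mstar_obj (G \<A>) (G \<A>)"
      by (intro E_G_Mstar) (auto simp: assembly_def split: if_splits)
  qed
qed

definition "G_mono = close (lam ''x1'' (lam ''x2'' (lam ''y1'' (lam ''y2'' (lam ''s''
  (pair E_G (pair E_G (lam ''e'' (lam ''m'' (V ''e'' \<^bold>\<cdot> (proj2 (proj2 (V ''s'')) \<^bold>\<cdot> V ''m'')))))))))))"

text \<open>A realizer of the order maps some \<open>B\<close> of \<open>\<B>\<close> into a given
  \<open>A\<close> of \<open>\<A>\<close>, so precomposing with it turns realizers from
  \<open>A\<close> to \<open>p\<close> into realizers from \<open>B\<close> to
  \<open>p\<close>.\<close>

lemma G_mono: "G_mono \<tturnstile> monotone_fun PP_obj PP_le Mstar_obj Mstar_le (graph PP_obj Mstar_obj G)"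
  unfolding G_mono_def monotone_fun_def
proof (rule close_I, ((rule rall_el_I)?, rule lam_I, simp add: subst_lam)+)
  fix \<A> \<B> f g s assume "s \<in> graph PP_obj Mstar_obj G \<A> f \<^bold>\<and> graph PP_obj Mstar_obj G \<B> g \<^bold>\<and> PP_le \<A> \<B>"
  note * = C_I[OF this, unfolded graph_def]
  have f: "f = G \<A>" using proj2_I[OF proj1_I[OF *]] by (simp add: realizes_Mstar_obj)
  have g: "g = G \<B>" using proj2_I[OF proj1_I[OF proj2_I[OF *]]] by (simp add: realizes_Mstar_obj)
  note le = PP_le_D[OF proj2_I[OF proj2_I[OF *]]]
  show "pair E_G (pair E_G (lam ''e'' (lam ''m'' (V ''e'' \<^bold>\<cdot> (proj2 (proj2 (C s)) \<^bold>\<cdot> V ''m''))))) \<tturnstile> Mstar_le f g"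
    unfolding f g
  proof (intro Mstar_le_I G_Mstar le E_G, rule lam_I, simp add: subst_lam)
    fix p e assume "e \<in> G \<A> p"
    then obtain A B where AB: "e \<in> A \<^bold>\<longrightarrow> p" "B \<in> \<B>" "proj2 (proj2 (C s)) \<tturnstile> B \<^bold>\<longrightarrow> A"
      using le(3) unfolding G_def by blast
    have "lam ''m'' (C e \<^bold>\<cdot> (proj2 (proj2 (C s)) \<^bold>\<cdot> V ''m'')) \<tturnstile> B \<^bold>\<longrightarrow> p"
      by (rule lam_I, simp) (intro Ap_I[OF C_I[OF AB(1)]] Ap_I[OF AB(3)] C_I)
    then show "lam ''m'' (C e \<^bold>\<cdot> (proj2 (proj2 (C s)) \<^bold>\<cdot> V ''m'')) \<tturnstile> G \<B> p"
      using AB(2) by (auto simp: realizes_def G_def)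
  qed
qed

section \<open>Joins in \<open>M\<^sup>*\<close>\<close>

text \<open>The index is stored beside the element because realizers of \<open>E (g n)\<close> and
  of bounds are computed from \<open>n\<close>; a plain union would lose it.\<close>

definition join_fun :: "nat set \<Rightarrow> (nat \<Rightarrow> nat set \<Rightarrow> nat set) \<Rightarrow> nat set \<Rightarrow> nat set" where
  "join_fun A g p = (\<Union>n\<in>A. {n} \<^bold>\<and> g n p)"

lemma join_fun_I: "s \<tturnstile> subN A n n \<Longrightarrow> t \<tturnstile> g n p \<Longrightarrow> pair s t \<tturnstile> join_fun A g p"
  using pair_I[of s "{n}" t "g n p"] unfolding join_fun_def realizes_subN
  by (auto simp: realizes_def)

lemma join_fun_E:
  assumes "t \<tturnstile> join_fun A g p"
  obtains n where "proj1 t \<tturnstile> subN A n n" "proj2 t \<tturnstile> g n p"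
proof -
  obtain n where n: "n \<in> A" "t \<tturnstile> {n} \<^bold>\<and> g n p"
    using assms unfolding join_fun_def realizes_def by blast
  have "proj1 t \<tturnstile> subN A n n"
    using n(1) proj1_I[OF n(2)] by (simp add: realizes_subN)
  then show thesis
    using proj2_I[OF n(2)] that by blast
qed

definition "E_join = close (lam ''g'' (lam ''k'' (lam ''s''
  (pair (proj1 (V ''s'')) (V ''g'' \<^bold>\<cdot> proj1 (V ''s'') \<^bold>\<cdot> V ''k'' \<^bold>\<cdot> proj2 (V ''s''))))))"

lemma E_join:
  "E_join \<tturnstile> rall (el (subN A)) (\<lambda>n. Mstar_obj (g n) (g n)) \<^bold>\<longrightarrow> E (join_fun A g)"
  unfolding E_join_def E_def
proof (rule close_I, rule lam_I, simp add: subst_lam, intro INTER_I, (rule lam_I, simp add: subst_lam)+)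
  fix c p q k s
  assume "c \<in> rall (el (subN A)) (\<lambda>n. Mstar_obj (g n) (g n))" "k \<in> p \<^bold>\<longrightarrow> q" "s \<in> join_fun A g p"
  note * = this[THEN C_I]
  obtain n where n: "proj1 (C s) \<tturnstile> subN A n n" "proj2 (C s) \<tturnstile> g n p"
    using join_fun_E[OF *(3)] by blast
  have "C c \<^bold>\<cdot> proj1 (C s) \<tturnstile> E (g n)"
    using rall_el_E[OF *(1) n(1)] by (simp add: realizes_Mstar_obj)
  from join_fun_I[where g = g, OF n(1) E_D[OF this *(2) n(2)]]
  show "pair (proj1 (C s)) (C c \<^bold>\<cdot> proj1 (C s) \<^bold>\<cdot> C k \<^bold>\<cdot> proj2 (C s)) \<tturnstile> join_fun A g q" .
qed

lemma join_fun_Mstar: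
  assumes "A \<noteq> {}" "c \<tturnstile> rall (el (subN A)) (\<lambda>n. Mstar_obj (g n) (g n))"
  shows "join_fun A g \<in> Mstar"
proof -
  obtain n where n: "n \<in> A" using assms(1) by blast
  then have s: "C n \<tturnstile> subN A n n" by (simp add: realizes_subN C_I)
  from rall_el_E[OF assms(2) this] have "g n \<in> Mstar" by (simp add: realizes_Mstar_obj)
  then obtain p m where "m \<in> g n p" unfolding Mstar_def by blast
  from Mstar_I[OF Ap_I[OF E_join assms(2)] join_fun_I[where g = g, OF s C_I[OF this]]] show ?thesis .
qed

definition "sup_join = close (lam ''g'' (pair
  (lam ''n'' (pair (V ''g'' \<^bold>\<cdot> V ''n'') (pair (E_join \<^bold>\<cdot> V ''g'') (lam ''m'' (pair (V ''n'') (V ''m''))))))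
  (lam ''w'' (lam ''u'' (pair (E_join \<^bold>\<cdot> V ''g'') (pair (V ''w'')
    (lam ''s'' (proj2 (proj2 (V ''u'' \<^bold>\<cdot> proj1 (V ''s''))) \<^bold>\<cdot> proj2 (V ''s'')))))))))"

lemma subst_E_join [simp]: "subst x a E_join = E_join" "subst x a sup_join = sup_join"
  by (simp_all add: E_join_def sup_join_def)

lemma sup_join:
  assumes "A \<noteq> {}"
  shows "sup_join \<tturnstile> rall (el (subN A)) (\<lambda>n. Mstar_obj (g n) (g n)) \<^bold>\<longrightarrow>
    sup_of Mstar_obj Mstar_le A g (join_fun A g)"
  unfolding sup_join_def sup_of_def bound_def[of _ _ _ "join_fun A g"]
proof (rule close_I, rule lam_I, simp add: subst_lam, intro pair_I;
    ((rule rall_el_I)?, rule lam_I, simp add: subst_lam)+)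
  fix c assume "c \<in> rall (el (subN A)) (\<lambda>n. Mstar_obj (g n) (g n))"
  note c = C_I[OF this]
  note E = Ap_I[OF E_join c] and M = join_fun_Mstar[OF assms c]
  {
    fix n n' assume "n' \<in> subN A n n"
    note n = C_I[OF this]
    have g: "g n \<in> Mstar" "C c \<^bold>\<cdot> C n' \<tturnstile> E (g n)"
      using rall_el_E[OF c n] by (simp_all add: realizes_Mstar_obj)
    show "pair (C c \<^bold>\<cdot> C n') (pair (E_join \<^bold>\<cdot> C c) (lam ''m'' (pair (C n') (V ''m'')))) \<tturnstile>
        Mstar_le (g n) (join_fun A g)"
      by (intro Mstar_le_I g M E, rule lam_I, simp) (rule join_fun_I[where g = g, OF n C_I])
  next
    fix w w' u assume "w' \<in> Mstar_obj w w" "u \<in> bound Mstar_le A g w"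
    note * = this[THEN C_I]
    have w: "w \<in> Mstar" "C w' \<tturnstile> E w" using *(1) by (simp_all add: realizes_Mstar_obj)
    show "pair (E_join \<^bold>\<cdot> C c) (pair (C w') (lam ''s'' (proj2 (proj2 (C u \<^bold>\<cdot> proj1 (V ''s''))) \<^bold>\<cdot> proj2 (V ''s'')))) \<tturnstile>
        Mstar_le (join_fun A g) w"
    proof (intro Mstar_le_I w M E, rule lam_I, simp)
      fix p s assume "s \<in> join_fun A g p"
      then obtain n where n: "proj1 (C s) \<tturnstile> subN A n n" "proj2 (C s) \<tturnstile> g n p"
        using join_fun_E[OF C_I] by blast
      show "proj2 (proj2 (C u \<^bold>\<cdot> proj1 (C s))) \<^bold>\<cdot> proj2 (C s) \<tturnstile> w p"
        by (rule Ap_I[OF Mstar_le_D(5)[OF boundD[OF *(2) n(1)]] n(2)])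
    qed
  }
qed

definition "represent_el = close (lam ''q'' (lam ''n'' (proj2 (V ''q'') \<^bold>\<cdot> (proj1 (V ''q'') \<^bold>\<cdot> V ''n''))))"

lemma represent_el: "represent_el \<tturnstile> represents Y A \<phi> g \<^bold>\<longrightarrow> rall (el (subN A)) (\<lambda>n. Y (g n) (g n))"
  unfolding represent_el_def
proof (rule close_I, ((rule rall_el_I)?, rule lam_I, simp add: subst_lam)+)
  fix q n n' assume "q \<in> represents Y A \<phi> g" "n' \<in> subN A n n"
  note * = this[THEN C_I]
  show "proj2 (C q) \<^bold>\<cdot> (proj1 (C q) \<^bold>\<cdot> C n') \<tturnstile> Y (g n) (g n)"
    by (rule represents_eq[OF *(1) represents_at[OF *]])
qed

definition "Mstar_joins = close (lam ''a'' (lam ''f'' (pair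
  (E_join \<^bold>\<cdot> (represent_el \<^bold>\<cdot> (represent \<^bold>\<cdot> V ''f'')))
  (join_of_sup \<^bold>\<cdot> Mstar_pre \<^bold>\<cdot> (represent \<^bold>\<cdot> V ''f'') \<^bold>\<cdot> (sup_join \<^bold>\<cdot> (represent_el \<^bold>\<cdot> (represent \<^bold>\<cdot> V ''f'')))))))"

lemma subst_Mstar_joins [simp]:
  "subst x a Mstar_joins = Mstar_joins" "subst x a represent_el = represent_el"
  by (simp_all add: Mstar_joins_def represent_el_def)

lemma Mstar_joins: "Mstar_joins \<tturnstile> has_joins Mstar_obj Mstar_le"
  unfolding Mstar_joins_def has_joins_def
proof (rule close_I, rule rall_el_I, rule lam_I, simp add: subst_lam, rule rall_I, rule lam_I, simp)
  fix A a \<phi> f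
  assume a: "a \<in> nonempty_subsets A A" and f: "f \<in> func (subN A) Mstar_obj \<phi>"
  have A: "A \<noteq> {}"
    using C_I[OF a] unfolding nonempty_subsets_def realizes_nabla by simp
  obtain g where q: "represent \<^bold>\<cdot> C f \<tturnstile> represents Mstar_obj A \<phi> g"
    using represent[OF f] by blast
  note c = Ap_I[OF represent_el q]
  have "E_join \<^bold>\<cdot> (represent_el \<^bold>\<cdot> (represent \<^bold>\<cdot> C f)) \<tturnstile> Mstar_obj (join_fun A g) (join_fun A g)"
    using join_fun_Mstar[OF A c] Ap_I[OF E_join c] by (simp add: realizes_Mstar_obj)
  from rex_el_I[where X = Mstar_obj and \<phi> = "is_join Mstar_obj Mstar_le A \<phi>", OF this
      Ap_I[OF Ap_I[OF Ap_I[OF join_of_sup Mstar_pre] q] Ap_I[OF sup_join[OF A] c]]]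
  show "pair (E_join \<^bold>\<cdot> (represent_el \<^bold>\<cdot> (represent \<^bold>\<cdot> C f)))
    (join_of_sup \<^bold>\<cdot> Mstar_pre \<^bold>\<cdot> (represent \<^bold>\<cdot> C f) \<^bold>\<cdot> (sup_join \<^bold>\<cdot> (represent_el \<^bold>\<cdot> (represent \<^bold>\<cdot> C f))))
    \<tturnstile> rex (el Mstar_obj) (is_join Mstar_obj Mstar_le A \<phi>)" .
qed

section \<open>Existence of the extension\<close>

definition supp :: "(nat set \<Rightarrow> nat set) \<Rightarrow> nat set" where
  "supp f = (\<Union>p. f p)"

definition fibre :: "(nat set \<Rightarrow> nat set) \<Rightarrow> nat \<Rightarrow> nat set set" where
  "fibre f n = {p. n \<in> f p}"

lemma fibre_nonempty: "n \<in> supp f \<Longrightarrow> fibre f n \<noteq> {}"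
  by (auto simp: supp_def fibre_def)

lemma supp_nonempty: "f \<in> Mstar \<Longrightarrow> supp f \<noteq> {}"
  by (simp add: Mstar_def supp_def)

text \<open>The functions \<open>k\<close> and \<open>y\<close> can be chosen outside the internal logic, since the realizers depend
  neither on \<open>\<A>\<close> nor on \<open>f\<close>.\<close>

definition completion_data :: "('y \<Rightarrow> 'y \<Rightarrow> nat set) \<Rightarrow> ('y \<Rightarrow> 'y \<Rightarrow> nat set) \<Rightarrow>
    (nat set set \<Rightarrow> 'y \<Rightarrow> nat set) \<Rightarrow> (nat set set \<Rightarrow> 'y) \<Rightarrow> ((nat set \<Rightarrow> nat set) \<Rightarrow> 'y) \<Rightarrow> nat set" where
  "completion_data Y le h k y =
    (rall (el PP_obj) (\<lambda>\<A>. Y (k \<A>) (k \<A>) \<^bold>\<and> h \<A> (k \<A>)) \<^bold>\<and>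
     rall (el (nabla Mstar)) (\<lambda>f. Y (y f) (y f) \<^bold>\<and> sup_of Y le (supp f) (\<lambda>n. k (fibre f n)) (y f)))"

definition "dat_k d = proj1 (proj1 d \<^bold>\<cdot> C 0)"
definition "dat_h d = proj2 (proj1 d \<^bold>\<cdot> C 0)"
definition "dat_y d = proj1 (proj2 d \<^bold>\<cdot> C 0)"
definition "dat_sup d = proj2 (proj2 d \<^bold>\<cdot> C 0)"

lemma subst_dat [simp]:
  "subst x a (dat_k d) = dat_k (subst x a d)" "subst x a (dat_h d) = dat_h (subst x a d)"
  "subst x a (dat_y d) = dat_y (subst x a d)" "subst x a (dat_sup d) = dat_sup (subst x a d)"
  by (simp_all add: dat_k_def dat_h_def dat_y_def dat_sup_def)

text \<open>Both quantifiers of \<open>completion_data\<close> range over objects in which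
  \<open>0\<close> realizes the existence of every element, so each component is one term for all
  arguments.\<close>

lemma
  assumes "d \<tturnstile> completion_data Y le h k y"
  shows dat_k: "\<A> \<noteq> {} \<Longrightarrow> dat_k d \<tturnstile> Y (k \<A>) (k \<A>)"
    and dat_h: "\<A> \<noteq> {} \<Longrightarrow> dat_h d \<tturnstile> h \<A> (k \<A>)"
    and dat_y: "f \<in> Mstar \<Longrightarrow> dat_y d \<tturnstile> Y (y f) (y f)"
    and dat_sup: "f \<in> Mstar \<Longrightarrow> dat_sup d \<tturnstile> sup_of Y le (supp f) (\<lambda>n. k (fibre f n)) (y f)"
proof -
  note d = assms[unfolded completion_data_def]
  have "proj1 d \<^bold>\<cdot> C 0 \<tturnstile> Y (k \<A>) (k \<A>) \<^bold>\<and> h \<A> (k \<A>)" if "\<A> \<noteq> {}" for \<A>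
    by (rule rall_el_E[OF proj1_I[OF d]]) (simp add: realizes_PP_obj C_UNIV that)
  then show "\<A> \<noteq> {} \<Longrightarrow> dat_k d \<tturnstile> Y (k \<A>) (k \<A>)" "\<A> \<noteq> {} \<Longrightarrow> dat_h d \<tturnstile> h \<A> (k \<A>)"
    unfolding dat_k_def dat_h_def by (blast intro: proj1_I proj2_I)+
  have "proj2 d \<^bold>\<cdot> C 0 \<tturnstile> Y (y f) (y f) \<^bold>\<and> sup_of Y le (supp f) (\<lambda>n. k (fibre f n)) (y f)"
    if "f \<in> Mstar" for f
    by (rule rall_el_E[OF proj2_I[OF d]]) (simp add: realizes_nabla C_UNIV that)
  then show "f \<in> Mstar \<Longrightarrow> dat_y d \<tturnstile> Y (y f) (y f)"
    "f \<in> Mstar \<Longrightarrow> dat_sup d \<tturnstile> sup_of Y le (supp f) (\<lambda>n. k (fibre f n)) (y f)"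
    unfolding dat_y_def dat_sup_def by (blast intro: proj1_I proj2_I)+
qed

lemmas graph_subN = graph_fun[where S = A and ex = "\<lambda>n. {n}" for A, folded subN_def]
lemmas graph_Mstar = graph_fun[where S = Mstar and ex = E, folded Mstar_obj_def]

definition "chosen t = pair (proj1 (fun_total t (C 0))) (proj2 (fun_total t (C 0)))"
definition "chosen_join r t =
  proj2 r \<^bold>\<cdot> C 0 \<^bold>\<cdot> (graph_fun \<^bold>\<cdot> proj1 (proj1 r) \<^bold>\<cdot> lam ''n'' (proj1 (fun_total t (C 0))))"

definition "make_data = close (lam ''r'' (lam ''t'' (pair (lam ''x'' (chosen (V ''t''))) (lam ''x'' (pair
  (proj1 (chosen_join (V ''r'') (V ''t'')))
  (sup_of_join \<^bold>\<cdot> proj1 (V ''r'') \<^bold>\<cdot> (represent_graph \<^bold>\<cdot> lam ''n'' (proj1 (fun_total (V ''t'') (C 0))))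
    \<^bold>\<cdot> proj2 (chosen_join (V ''r'') (V ''t''))))))))"

lemma make_data:
  assumes "r \<in> preord Y le \<^bold>\<and> has_joins Y le" "t \<in> func PP_obj Y h"
  shows "\<exists>k y. make_data \<^bold>\<cdot> C r \<^bold>\<cdot> C t \<tturnstile> completion_data Y le h k y"
proof -
  note r = C_I[OF assms(1)] and t = C_I[OF assms(2)]
  note p = proj1_I[OF r]
  let ?c = "fun_total (C t) (C 0)"
  \<comment> \<open>\<open>0\<close> realizes every nonempty \<open>\<A>\<close>, so totality of
    \<open>h\<close> gives the same two numbers for all of them.\<close>
  have "\<exists>c. \<A> \<noteq> {} \<longrightarrow> proj1 ?c \<tturnstile> Y c c \<and> proj2 ?c \<tturnstile> h \<A> c" for \<A>
    using rex_el_E[OF fun_total[OF t, of "C 0" \<A>]] by (metis C_UNIV realizes_PP_obj)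
  then obtain k where k: "\<And>\<A>. \<A> \<noteq> {} \<Longrightarrow> proj1 ?c \<tturnstile> Y (k \<A>) (k \<A>)" "\<And>\<A>. \<A> \<noteq> {} \<Longrightarrow> proj2 ?c \<tturnstile> h \<A> (k \<A>)"
    by metis
  have K: "lam ''n'' (proj1 ?c) \<tturnstile> rall (el (subN (supp f))) (\<lambda>n. Y (k (fibre f n)) (k (fibre f n)))" for f
  proof (rule rall_el_I, rule lam_I, simp)
    fix n n' assume "n' \<in> subN (supp f) n n"
    from C_I[OF this] show "proj1 ?c \<tturnstile> Y (k (fibre f n)) (k (fibre f n))"
      by (intro k fibre_nonempty) (simp add: realizes_subN)
  qed
  let ?\<phi> = "\<lambda>f. graph (subN (supp f)) Y (\<lambda>n. k (fibre f n))"
  \<comment> \<open>The index set is realized by \<open>0\<close> and the family by a term without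
    \<open>f\<close>, so the realizer of the join is the same for all \<open>f\<close>.\<close>
  have J: "chosen_join (C r) (C t) \<tturnstile> rex (el Y) (is_join Y le (supp f) (?\<phi> f))" if "f \<in> Mstar" for f
  proof -
    have A: "C 0 \<tturnstile> nonempty_subsets (supp f) (supp f)"
      by (simp add: nonempty_subsets_def realizes_nabla C_UNIV supp_nonempty that)
    have "graph_fun \<^bold>\<cdot> proj1 (proj1 (C r)) \<^bold>\<cdot> lam ''n'' (proj1 ?c) \<tturnstile> func (subN (supp f)) Y (?\<phi> f)"
      by (rule graph_subN[OF pre_obj[OF p] K])
    from rall_E[OF rall_el_E[OF proj2_I[OF r, unfolded has_joins_def] A], OF this]
    show ?thesis unfolding chosen_join_def .
  qed
  then have "\<exists>z. f \<in> Mstar \<longrightarrow> proj1 (chosen_join (C r) (C t)) \<tturnstile> Y z z \<and>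
      proj2 (chosen_join (C r) (C t)) \<tturnstile> is_join Y le (supp f) (?\<phi> f) z" for f
    using rex_el_E[OF J[of f]] by metis
  then obtain y where y: "\<And>f. f \<in> Mstar \<Longrightarrow> proj1 (chosen_join (C r) (C t)) \<tturnstile> Y (y f) (y f)"
    "\<And>f. f \<in> Mstar \<Longrightarrow> proj2 (chosen_join (C r) (C t)) \<tturnstile> is_join Y le (supp f) (?\<phi> f) (y f)"
    by metis
  \<comment> \<open>\<open>chosen_join\<close> contains the binder \<open>''n''\<close>, so
    substitution into it is stated only for the names in use.\<close>
  have subst: "subst x a (chosen (V z)) = chosen (subst x a (V z))"
    "subst ''r'' a (chosen_join (V ''r'') s) = chosen_join (C a) (subst ''r'' a s)"
    "subst ''t'' a (chosen_join (C b) (V ''t'')) = chosen_join (C b) (C a)"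
    "subst x a (chosen (C b)) = chosen (C b)"
    "subst ''x'' a (chosen_join (C b) (C b')) = chosen_join (C b) (C b')" for x a b b' s z
    by (simp_all add: chosen_def chosen_join_def subst_lam)
  have "make_data \<tturnstile> {r} \<^bold>\<longrightarrow> {t} \<^bold>\<longrightarrow> completion_data Y le h k y"
    unfolding make_data_def completion_data_def
  proof (rule close_I, (rule lam_I, simp add: subst_lam subst)+, rule pair_I;
      rule rall_el_I, rule lam_I, simp add: subst_lam subst)
    fix \<A> a assume "a \<in> PP_obj \<A> \<A>"
    from C_I[OF this] show "chosen (C t) \<tturnstile> Y (k \<A>) (k \<A>) \<^bold>\<and> h \<A> (k \<A>)"
      unfolding chosen_def by (intro pair_I k) (simp_all add: realizes_PP_obj)
  next
    fix f a assume "a \<in> nabla Mstar f f"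
    from C_I[OF this] have f: "f \<in> Mstar" by (simp add: realizes_nabla)
    note q = Ap_I[OF represent_graph[where g = "\<lambda>n. k (fibre f n)" and Y = Y] K]
    note sup = Ap_I[OF Ap_I[OF Ap_I[OF sup_of_join p] q] y(2)[OF f]]
    show "pair (proj1 (chosen_join (C r) (C t))) (sup_of_join \<^bold>\<cdot> proj1 (C r) \<^bold>\<cdot>
        (represent_graph \<^bold>\<cdot> lam ''n'' (proj1 ?c)) \<^bold>\<cdot> proj2 (chosen_join (C r) (C t)))
        \<tturnstile> Y (y f) (y f) \<^bold>\<and> sup_of Y le (supp f) (\<lambda>n. k (fibre f n)) (y f)"
      by (rule pair_I[OF y(1)[OF f] sup])
  qed
  then have "make_data \<^bold>\<cdot> C r \<^bold>\<cdot> C t \<tturnstile> completion_data Y le h k y"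
    by (rule Ap_I[OF Ap_I]) (simp_all add: C_I)
  then show ?thesis by blast
qed

section \<open>Monotonicity of the picked values \<open>k\<close> and \<open>y\<close>\<close>

definition "k_mono m d s = m \<^bold>\<cdot> C 0 \<^bold>\<cdot> C 0 \<^bold>\<cdot> dat_k d \<^bold>\<cdot> dat_k d \<^bold>\<cdot> pair (dat_h d) (pair (dat_h d) s)"

lemma monotone_funD:
  assumes "m \<tturnstile> monotone_fun X leX Y leY F" "a \<tturnstile> X x x" "a' \<tturnstile> X x' x'" "b \<tturnstile> Y y y" "b' \<tturnstile> Y y' y'"
    "s \<tturnstile> F x y" "s' \<tturnstile> F x' y'" "r \<tturnstile> leX x x'"
  shows "m \<^bold>\<cdot> a \<^bold>\<cdot> a' \<^bold>\<cdot> b \<^bold>\<cdot> b' \<^bold>\<cdot> pair s (pair s' r) \<tturnstile> leY y y'"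
  using Ap_I[OF rall_el_E[OF rall_el_E[OF rall_el_E[OF rall_el_E[OF
    assms(1)[unfolded monotone_fun_def] assms(2)] assms(3)] assms(4)] assms(5)]
    pair_I[OF assms(6) pair_I[OF assms(7,8)]]] .

lemma k_mono:
  assumes "m \<tturnstile> monotone_fun PP_obj PP_le Y le h" "d \<tturnstile> completion_data Y le h k y" "s \<tturnstile> PP_le \<A> \<B>"
  shows "k_mono m d s \<tturnstile> le (k \<A>) (k \<B>)"
proof -
  have C: "C 0 \<tturnstile> PP_obj \<A> \<A>" "C 0 \<tturnstile> PP_obj \<B> \<B>"
    using PP_le_D[OF assms(3)] by (simp_all add: realizes_PP_obj C_UNIV)
  show ?thesis
    unfolding k_mono_def
    using monotone_funD[OF assms(1) C dat_k[OF assms(2)] dat_k[OF assms(2)] dat_h[OF assms(2)]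
      dat_h[OF assms(2)] assms(3)] PP_le_D[OF assms(3)] by blast
qed

definition "fibre_le p m d s = pre_trans p (k_mono m d (C iden)) (proj1 (dat_sup d) \<^bold>\<cdot> s)"

text \<open>Inclusion of fibres is realized by the identity, so \<open>k\<close> compares them, and
  the value at the larger fibre lies below \<open>y g\<close>. The term mentions the fibres only
  through a realizer of the index \<open>i\<close>, which makes it uniform in \<open>f\<close>,
  \<open>g\<close> and \<open>n\<close>.\<close>

lemma fibre_le:
  assumes "p \<tturnstile> preord Y le" "m \<tturnstile> monotone_fun PP_obj PP_le Y le h" "d \<tturnstile> completion_data Y le h k y"
    and "s \<tturnstile> subN (supp g) i i" "fibre f n \<subseteq> fibre g i" "n \<in> supp f" "g \<in> Mstar"
  shows "fibre_le p m d s \<tturnstile> le (k (fibre f n)) (y g)"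
  unfolding fibre_le_def
  using pre_trans[OF assms(1) k_mono[OF assms(2,3) PP_le_subset[OF fibre_nonempty[OF assms(6)] assms(5)]]
    sup_of_bound[OF dat_sup[OF assms(3,7)] assms(4)]] .

lemma subst_fibre_le [simp]:
  "subst x a (k_mono m d s) = k_mono (subst x a m) (subst x a d) (subst x a s)"
  "subst x a (fibre_le p m d s) = fibre_le (subst x a p) (subst x a m) (subst x a d) (subst x a s)"
  by (simp_all add: k_mono_def fibre_le_def)

text \<open>The term \<open>u\<close> works for all \<open>p\<close> at once, so \<open>n\<close> is
  sent to one number \<open>i\<close> that lies in \<open>g p\<close> for every \<open>p\<close> in
  the fibre over \<open>n\<close>.\<close>

lemma tracks_fibre:
  assumes "\<And>p. u \<tturnstile> f p \<^bold>\<longrightarrow> g p" "s \<tturnstile> subN (supp f) n n"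
  obtains i where "u \<^bold>\<cdot> s \<tturnstile> subN (supp g) i i" "fibre f n \<subseteq> fibre g i"
proof -
  have n: "n \<in> supp f" "den s = Some n"
    using assms(2)[unfolded realizes_subN] by (simp_all add: realizes_def)
  have *: "u \<^bold>\<cdot> s \<tturnstile> g p" if "n \<in> f p" for p
    using Ap_I[OF assms(1)] n(2) that unfolding realizes_def by blast
  \<comment> \<open>A member of the fibre shows that the application denotes; its value
    \<open>i\<close> is then independent of \<open>p\<close>.\<close>
  obtain p where "n \<in> f p" using n(1) by (auto simp: supp_def)
  from *[OF this] obtain i where i: "den (u \<^bold>\<cdot> s) = Some i" "i \<in> g p"
    unfolding realizes_def by blast
  then have "u \<^bold>\<cdot> s \<tturnstile> subN (supp g) i i"
    unfolding realizes_subN by (auto simp: supp_def realizes_def)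
  moreover have "fibre f n \<subseteq> fibre g i"
    using * i(1) by (auto simp: fibre_def realizes_def)
  ultimately show thesis using that by blast
qed

definition "y_mono = close (lam ''p'' (lam ''m'' (lam ''d'' (lam ''s''
  (proj2 (dat_sup (V ''d'')) \<^bold>\<cdot> dat_y (V ''d'') \<^bold>\<cdot> lam ''n''
    (fibre_le (V ''p'') (V ''m'') (V ''d'') (proj2 (proj2 (V ''s'')) \<^bold>\<cdot> V ''n'')))))))"

text \<open>The values of \<open>y\<close> were picked separately, so the comparison comes from
  leastness of \<open>y f\<close>: each fibre of \<open>f\<close> is included in a fibre of
  \<open>g\<close>, hence \<open>y g\<close> bounds every \<open>k (fibre f n)\<close>.\<close>

lemma y_mono:
  "y_mono \<tturnstile> preord Y le \<^bold>\<longrightarrow> monotone_fun PP_obj PP_le Y le h \<^bold>\<longrightarrow> completion_data Y le h k y \<^bold>\<longrightarrow>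
    Mstar_le f g \<^bold>\<longrightarrow> le (y f) (y g)"
  unfolding y_mono_def
proof (rule close_I, (rule lam_I, simp add: subst_lam)+)
  fix p m d s
  assume "p \<in> preord Y le" "m \<in> monotone_fun PP_obj PP_le Y le h" "d \<in> completion_data Y le h k y"
    "s \<in> Mstar_le f g"
  note * = this[THEN C_I]
  note s = Mstar_le_D[OF *(4)]
  have "lam ''n'' (fibre_le (C p) (C m) (C d) (proj2 (proj2 (C s)) \<^bold>\<cdot> V ''n'')) \<tturnstile>
      bound le (supp f) (\<lambda>n. k (fibre f n)) (y g)"
    unfolding bound_def
  proof (rule rall_el_I, rule lam_I, simp)
    fix n n' assume "n' \<in> subN (supp f) n n"
    note n = C_I[OF this]
    then obtain i where i: "proj2 (proj2 (C s)) \<^bold>\<cdot> C n' \<tturnstile> subN (supp g) i i" "fibre f n \<subseteq> fibre g i"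
      by (rule tracks_fibre[where f = f and g = g, OF s(5)])
    show "fibre_le (C p) (C m) (C d) (proj2 (proj2 (C s)) \<^bold>\<cdot> C n') \<tturnstile> le (k (fibre f n)) (y g)"
      by (rule fibre_le[OF *(1-3) i _ s(2)]) (use n in \<open>simp add: realizes_subN\<close>)
  qed
  from sup_of_least[OF dat_sup[OF *(3) s(1)] dat_y[OF *(3) s(2)] this]
  show "proj2 (dat_sup (C d)) \<^bold>\<cdot> dat_y (C d) \<^bold>\<cdot> lam ''n'' (fibre_le (C p) (C m) (C d)
      (proj2 (proj2 (C s)) \<^bold>\<cdot> V ''n'')) \<tturnstile> le (y f) (y g)" .
qed

lemma subst_y_mono [simp]: "subst x a y_mono = y_mono" "subst x a make_data = make_data"
  by (simp_all add: y_mono_def make_data_def)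

lemma realizes_graph_Mstar:
  assumes "s \<tturnstile> graph Mstar_obj Y y f z"
  shows "f \<in> Mstar" "proj2 s \<tturnstile> Y (y f) z"
  using proj1_I[OF assms[unfolded graph_def]] proj2_I[OF assms[unfolded graph_def]]
  by (simp_all add: realizes_Mstar_obj)

definition "extend_mono = close (lam ''p'' (lam ''m'' (lam ''d'' (lam ''x1'' (lam ''x2'' (lam ''y1'' (lam ''y2'' (lam ''s''
  (pre_extr (V ''p'') (pre_extl (V ''p'') (y_mono \<^bold>\<cdot> V ''p'' \<^bold>\<cdot> V ''m'' \<^bold>\<cdot> V ''d'' \<^bold>\<cdot> proj2 (proj2 (V ''s'')))
    (proj2 (proj1 (V ''s'')))) (proj2 (proj1 (proj2 (V ''s'')))))))))))))"

lemma extend_mono: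
  "extend_mono \<tturnstile> preord Y le \<^bold>\<longrightarrow> monotone_fun PP_obj PP_le Y le h \<^bold>\<longrightarrow> completion_data Y le h k y \<^bold>\<longrightarrow>
    monotone_fun Mstar_obj Mstar_le Y le (graph Mstar_obj Y y)"
  unfolding extend_mono_def monotone_fun_def[of Mstar_obj]
proof (rule close_I, ((rule rall_el_I)?, rule lam_I, simp add: subst_lam)+)
  fix p m d f g z z' s
  assume "p \<in> preord Y le" "m \<in> monotone_fun PP_obj PP_le Y le h" "d \<in> completion_data Y le h k y"
    "s \<in> graph Mstar_obj Y y f z \<^bold>\<and> graph Mstar_obj Y y g z' \<^bold>\<and> Mstar_le f g"
  note * = this[THEN C_I]
  note s1 = realizes_graph_Mstar(2)[OF proj1_I[OF *(4)]]
    and s2 = realizes_graph_Mstar(2)[OF proj1_I[OF proj2_I[OF *(4)]]]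
  show "pre_extr (C p) (pre_extl (C p) (y_mono \<^bold>\<cdot> C p \<^bold>\<cdot> C m \<^bold>\<cdot> C d \<^bold>\<cdot> proj2 (proj2 (C s)))
    (proj2 (proj1 (C s)))) (proj2 (proj1 (proj2 (C s)))) \<tturnstile> le z z'"
    by (rule pre_extr[OF *(1) pre_extl[OF *(1) Ap_I[OF Ap_I[OF Ap_I[OF Ap_I[OF y_mono *(1)] *(2)] *(3)]
      proj2_I[OF proj2_I[OF *(4)]]] s1] s2])
qed

section \<open>The extension agrees with \<open>h\<close> along \<open>G\<close>\<close>

definition "extend_iso1 m d = proj2 (dat_sup d) \<^bold>\<cdot> dat_k d \<^bold>\<cdot> lam ''e'' (k_mono m d (V ''e''))"
definition "extend_iso2 p m d = pre_trans p (k_mono m d (C iden)) (proj1 (dat_sup d) \<^bold>\<cdot> C iden)"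

text \<open>The index is its own realizer of the order: if \<open>e\<close> lies in
  \<open>G \<A> p\<close>, it maps some \<open>A\<close> of \<open>\<A>\<close> into
  \<open>p\<close>, so \<open>e\<close> itself realizes that the fibre over \<open>e\<close> is
  below \<open>\<A>\<close>.\<close>

lemma extend_iso1:
  assumes "C m \<tturnstile> monotone_fun PP_obj PP_le Y le h" "C d \<tturnstile> completion_data Y le h k y" "\<A> \<noteq> {}"
  shows "extend_iso1 (C m) (C d) \<tturnstile> le (y (G \<A>)) (k \<A>)"
proof -
  have "lam ''e'' (k_mono (C m) (C d) (V ''e'')) \<tturnstile> bound le (supp (G \<A>)) (\<lambda>n. k (fibre (G \<A>) n)) (k \<A>)"
    unfolding bound_def
  proof (rule rall_el_I, rule lam_I, simp)
    fix n e assume "e \<in> subN (supp (G \<A>)) n n"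
    then have "e = n" "e \<in> supp (G \<A>)" by (auto simp: subN_def assembly_def split: if_splits)
    then have "C e \<tturnstile> PP_le (fibre (G \<A>) n) \<A>"
      by (intro PP_le_I fibre_nonempty assms) (auto simp: fibre_def G_def intro: C_I)
    then show "k_mono (C m) (C d) (C e) \<tturnstile> le (k (fibre (G \<A>) n)) (k \<A>)"
      by (rule k_mono[OF assms(1,2)])
  qed
  from sup_of_least[OF dat_sup[OF assms(2) G_Mstar[OF assms(3)]] dat_k[OF assms(2,3)] this]
  show ?thesis unfolding extend_iso1_def .
qed

text \<open>The identity maps each \<open>A\<close> into itself, so the fibre over
  \<open>iden\<close> contains all of \<open>\<A>\<close>.\<close>

lemma extend_iso2:
  assumes "p \<tturnstile> preord Y le" "m \<tturnstile> monotone_fun PP_obj PP_le Y le h" "d \<tturnstile> completion_data Y le h k y" "\<A> \<noteq> {}"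
  shows "extend_iso2 p m d \<tturnstile> le (k \<A>) (y (G \<A>))"
proof -
  have "\<A> \<subseteq> fibre (G \<A>) iden" by (auto simp: fibre_def G_iden)
  moreover have "C iden \<tturnstile> subN (supp (G \<A>)) iden iden"
    using assms(4) G_iden by (auto simp: realizes_subN supp_def C_I)
  ultimately show ?thesis
    unfolding extend_iso2_def
    using pre_trans[OF assms(1) k_mono[OF assms(2,3) PP_le_subset[OF assms(4)]]
      sup_of_bound[OF dat_sup[OF assms(3) G_Mstar[OF assms(4)]]]] by blast
qed

text \<open>\<open>extend_iso1\<close> binds \<open>''e''\<close> around \<open>m\<close> and
  \<open>d\<close>, so a substitution for that name would not reach them.\<close>

lemma subst_extend_iso [simp]:
  "x \<noteq> ''e'' \<Longrightarrow> subst x a (extend_iso1 m d) = extend_iso1 (subst x a m) (subst x a d)"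
  "subst x a (extend_iso2 p m d) = extend_iso2 (subst x a p) (subst x a m) (subst x a d)"
  by (simp_all add: extend_iso1_def extend_iso2_def subst_lam)

definition "extend_iso = close (lam ''p'' (lam ''t'' (lam ''m'' (lam ''d'' (lam ''x'' (lam ''y'' (lam ''z'' (lam ''s'' (pair
  (pre_extr (V ''p'') (pre_extl (V ''p'') (extend_iso1 (V ''m'') (V ''d''))
    (proj2 (proj2 (proj2 (proj1 (V ''s''))))))
    (fun_single (V ''t'') (dat_h (V ''d'')) (proj2 (V ''s''))))
  (pre_extr (V ''p'') (pre_extl (V ''p'') (extend_iso2 (V ''p'') (V ''m'') (V ''d''))
    (fun_single (V ''t'') (dat_h (V ''d'')) (proj2 (V ''s''))))
    (proj2 (proj2 (proj2 (proj1 (V ''s'')))))))))))))))"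

text \<open>Distinct elements of an assembly are never internally equal, so the intermediate value
  of the composite must be \<open>g \<A>\<close>.\<close>

lemma func_comp_G:
  assumes "s \<tturnstile> func_comp Mstar_obj F (graph X Mstar_obj g) \<A> z"
  shows "proj1 (proj1 (proj2 s)) \<tturnstile> X \<A> \<A>" "proj2 (proj2 s) \<tturnstile> F (g \<A>) z"
proof -
  obtain f where "proj2 s \<tturnstile> (X \<A> \<A> \<^bold>\<and> Mstar_obj (g \<A>) f) \<^bold>\<and> F f z"
    using rex_el_E[OF assms[unfolded func_comp_def graph_def]] by blast
  then show "proj1 (proj1 (proj2 s)) \<tturnstile> X \<A> \<A>" "proj2 (proj2 s) \<tturnstile> F (g \<A>) z"
    using proj1_I proj2_I by (metis realizes_Mstar_obj)+
qed

text \<open>The values \<open>z\<close> and \<open>z'\<close> agree with \<open>y (G \<A>)\<close>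
  and \<open>k \<A>\<close> only up to the equality of \<open>Y\<close>, so the two inequalities
  between the latter have to be transported.\<close>

lemma extend_iso:
  "extend_iso \<tturnstile> preord Y le \<^bold>\<longrightarrow> func PP_obj Y h \<^bold>\<longrightarrow> monotone_fun PP_obj PP_le Y le h \<^bold>\<longrightarrow>
    completion_data Y le h k y \<^bold>\<longrightarrow>
    iso_fun PP_obj Y le (func_comp Mstar_obj (graph Mstar_obj Y y) (graph PP_obj Mstar_obj G)) h"
  unfolding extend_iso_def iso_fun_def iso_def
proof (rule close_I, ((rule rall_el_I)?, rule lam_I, simp add: subst_lam)+)
  fix p t m d \<A> a z b z' b' s
  assume "p \<in> preord Y le" "t \<in> func PP_obj Y h" "m \<in> monotone_fun PP_obj PP_le Y le h"
    "d \<in> completion_data Y le h k y"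
    "s \<in> func_comp Mstar_obj (graph Mstar_obj Y y) (graph PP_obj Mstar_obj G) \<A> z \<^bold>\<and> h \<A> z'"
  note * = this[THEN C_I]
  note FG = func_comp_G[OF proj1_I[OF *(5)]]
  have \<A>: "\<A> \<noteq> {}" using FG(1) by (simp add: realizes_PP_obj)
  note u = realizes_graph_Mstar(2)[OF FG(2)]
  note v = fun_single[OF *(2) dat_h[OF *(4) \<A>] proj2_I[OF *(5)]]
  show "pair
     (pre_extr (C p) (pre_extl (C p) (extend_iso1 (C m) (C d)) (proj2 (proj2 (proj2 (proj1 (C s))))))
       (fun_single (C t) (dat_h (C d)) (proj2 (C s))))
     (pre_extr (C p) (pre_extl (C p) (extend_iso2 (C p) (C m) (C d))
       (fun_single (C t) (dat_h (C d)) (proj2 (C s)))) (proj2 (proj2 (proj2 (proj1 (C s)))))) \<tturnstile>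
     le z z' \<^bold>\<and> le z' z"
    by (rule pair_I[OF pre_extr[OF *(1) pre_extl[OF *(1) extend_iso1[OF *(3,4) \<A>] u] v]
      pre_extr[OF *(1) pre_extl[OF *(1) extend_iso2[OF *(1,3,4) \<A>] v] u]])
qed

section \<open>The extension preserves joins\<close>

definition "comp_represents = close (lam ''q'' (lam ''d'' (pair
  (lam ''n'' (pair (represent_el \<^bold>\<cdot> V ''q'' \<^bold>\<cdot> V ''n'') (pair (proj1 (V ''q'') \<^bold>\<cdot> V ''n'')
    (pair (represent_el \<^bold>\<cdot> V ''q'' \<^bold>\<cdot> V ''n'') (dat_y (V ''d''))))))
  (lam ''s'' (proj2 (proj2 (proj2 (V ''s''))))))))"

lemma comp_represents:
  "comp_represents \<tturnstile> represents Mstar_obj A \<phi> g \<^bold>\<longrightarrow> completion_data Y le h k y \<^bold>\<longrightarrow>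
    represents Y A (func_comp Mstar_obj (graph Mstar_obj Y y) \<phi>) (\<lambda>n. y (g n))"
  unfolding comp_represents_def represents_def[of Y]
proof (rule close_I, (rule lam_I, simp add: subst_lam)+, rule pair_I;
    (intro INTER_I rall_el_I)?, rule lam_I, simp add: subst_lam)
  fix q d assume "q \<in> represents Mstar_obj A \<phi> g" "d \<in> completion_data Y le h k y"
  note * = this[THEN C_I]
  {
    fix n n' assume "n' \<in> subN A n n"
    note n = C_I[OF this]
    note e = rall_el_E[OF Ap_I[OF represent_el *(1)] n]
    have g: "g n \<in> Mstar" using e by (simp add: realizes_Mstar_obj)
    show "pair (represent_el \<^bold>\<cdot> C q \<^bold>\<cdot> C n') (pair (proj1 (C q) \<^bold>\<cdot> C n')
        (pair (represent_el \<^bold>\<cdot> C q \<^bold>\<cdot> C n') (dat_y (C d)))) \<tturnstile>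
        func_comp Mstar_obj (graph Mstar_obj Y y) \<phi> n (y (g n))"
      unfolding func_comp_def graph_def
      by (intro rex_el_I[where x = "g n"] pair_I e represents_at[OF *(1) n] dat_y[OF *(2) g])
  next
    fix n z s assume "s \<in> func_comp Mstar_obj (graph Mstar_obj Y y) \<phi> n z"
    then obtain f where f: "proj2 (C s) \<tturnstile> \<phi> n f \<^bold>\<and> graph Mstar_obj Y y f z"
      using rex_el_E[OF C_I] unfolding func_comp_def by blast
    have "g n = f" using represents_eq[OF *(1), OF proj1_I[OF f]] by (simp add: realizes_Mstar_obj)
    then show "proj2 (proj2 (proj2 (C s))) \<tturnstile> Y (y (g n)) z"
      using realizes_graph_Mstar(2)[OF proj2_I[OF f]] by simp
  }
qed

definition "to_join c j = proj2 (proj2 (proj2 j \<^bold>\<cdot> (E_join \<^bold>\<cdot> c) \<^bold>\<cdot> proj1 (sup_join \<^bold>\<cdot> c)))"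

text \<open>An internal join \<open>z\<close> need not be \<open>join_fun A g\<close> itself;
  leastness of \<open>z\<close> still yields a number tracking it into the explicit join.\<close>

lemma to_join:
  assumes "A \<noteq> {}" "c \<tturnstile> rall (el (subN A)) (\<lambda>n. Mstar_obj (g n) (g n))"
    "j \<tturnstile> sup_of Mstar_obj Mstar_le A g z"
  shows "to_join c j \<tturnstile> z p \<^bold>\<longrightarrow> join_fun A g p"
proof -
  have "E_join \<^bold>\<cdot> c \<tturnstile> Mstar_obj (join_fun A g) (join_fun A g)"
    using join_fun_Mstar[OF assms(1,2)] Ap_I[OF E_join assms(2)] by (simp add: realizes_Mstar_obj)
  from Mstar_le_D(5)[OF sup_of_least[OF assms(3) this
      proj1_I[OF Ap_I[OF sup_join[OF assms(1)] assms(2), unfolded sup_of_def]]]]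
  show ?thesis unfolding to_join_def .
qed

text \<open>The tracked value is one pair for the whole fibre of \<open>z\<close> over
  \<open>m\<close>, and its first component names one index \<open>n\<close>; hence the fibre lands
  in a single fibre of a single \<open>g n\<close>.\<close>

lemma to_join_fibre:
  assumes "A \<noteq> {}" "c \<tturnstile> rall (el (subN A)) (\<lambda>n. Mstar_obj (g n) (g n))"
    "j \<tturnstile> sup_of Mstar_obj Mstar_le A g z" "s \<tturnstile> subN (supp z) m m"
  obtains n i where "proj1 (to_join c j \<^bold>\<cdot> s) \<tturnstile> subN A n n"
    "proj2 (to_join c j \<^bold>\<cdot> s) \<tturnstile> subN (supp (g n)) i i" "fibre z m \<subseteq> fibre (g n) i"
proof -
  obtain i where i: "to_join c j \<^bold>\<cdot> s \<tturnstile> subN (supp (join_fun A g)) i i" "fibre z m \<subseteq> fibre (join_fun A g) i"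
    by (rule tracks_fibre[where f = z and g = "join_fun A g", OF to_join[OF assms(1-3)] assms(4)])
  then have den: "den (to_join c j \<^bold>\<cdot> s) = Some i" and "i \<in> supp (join_fun A g)"
    by (simp_all add: realizes_subN) (simp_all add: realizes_def)
  then obtain n l p where n: "i = pe n l" "n \<in> A" "l \<in> g n p"
    unfolding supp_def join_fun_def rconj_def by blast
  have mem: "pe n l \<in> {n} \<^bold>\<and> {l}" by (auto simp: rconj_def)
  then have "to_join c j \<^bold>\<cdot> s \<tturnstile> {n} \<^bold>\<and> {l}"
    using den n(1) unfolding realizes_def by blast
  from proj1_I[OF this] proj2_I[OF this]
  have "proj1 (to_join c j \<^bold>\<cdot> s) \<tturnstile> subN A n n" "proj2 (to_join c j \<^bold>\<cdot> s) \<tturnstile> subN (supp (g n)) l l"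
    using n by (auto simp: realizes_subN supp_def)
  moreover have "fibre z m \<subseteq> fibre (g n) l"
    using i(2) n(1) by (auto simp: fibre_def join_fun_def rconj_def)
  ultimately show thesis using that by blast
qed

lemma subst_to_join [simp]: "subst x a (to_join c j) = to_join (subst x a c) (subst x a j)"
  by (simp add: to_join_def)

definition "extend_sup = close (lam ''p'' (lam ''m'' (lam ''d'' (lam ''c'' (lam ''j'' (lam ''r'' (pair
  (lam ''n'' (pre_extr (V ''p'') (y_mono \<^bold>\<cdot> V ''p'' \<^bold>\<cdot> V ''m'' \<^bold>\<cdot> V ''d'' \<^bold>\<cdot> (proj1 (V ''j'') \<^bold>\<cdot> V ''n'')) (V ''r'')))
  (lam ''v'' (lam ''u'' (pre_extl (V ''p'') (proj2 (dat_sup (V ''d'')) \<^bold>\<cdot> V ''v'' \<^bold>\<cdot> lam ''i''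
    (pre_trans (V ''p'')
      (fibre_le (V ''p'') (V ''m'') (V ''d'') (proj2 (to_join (V ''c'') (V ''j'') \<^bold>\<cdot> V ''i'')))
      (V ''u'' \<^bold>\<cdot> proj1 (to_join (V ''c'') (V ''j'') \<^bold>\<cdot> V ''i''))))
    (V ''r'')))))))))))"

text \<open>The bound is monotonicity of \<open>y\<close> along \<open>g n \<le> z\<close>. For
  leastness, each \<open>k (fibre z i)\<close> lies below some \<open>y (g n)\<close>, hence below
  any bound; the index \<open>n\<close> is computed by \<open>to_join\<close>.\<close>

lemma extend_sup:
  assumes "A \<noteq> {}" "z \<in> Mstar"
  shows "extend_sup \<tturnstile> preord Y le \<^bold>\<longrightarrow> monotone_fun PP_obj PP_le Y le h \<^bold>\<longrightarrow> completion_data Y le h k y \<^bold>\<longrightarrow>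
    rall (el (subN A)) (\<lambda>n. Mstar_obj (g n) (g n)) \<^bold>\<longrightarrow> sup_of Mstar_obj Mstar_le A g z \<^bold>\<longrightarrow> Y (y z) w \<^bold>\<longrightarrow>
    sup_of Y le A (\<lambda>n. y (g n)) w"
  unfolding extend_sup_def sup_of_def[of Y] bound_def[of _ _ _ w]
proof (rule close_I, (rule lam_I, simp add: subst_lam)+, rule pair_I;
    ((rule rall_el_I)?, rule lam_I, simp add: subst_lam)+)
  fix p m d c j r
  assume "p \<in> preord Y le" "m \<in> monotone_fun PP_obj PP_le Y le h" "d \<in> completion_data Y le h k y"
    "c \<in> rall (el (subN A)) (\<lambda>n. Mstar_obj (g n) (g n))" "j \<in> sup_of Mstar_obj Mstar_le A g z" "r \<in> Y (y z) w"
  note * = this[THEN C_I]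
  {
    fix n n' assume "n' \<in> subN A n n"
    note n = C_I[OF this]
    show "pre_extr (C p) (y_mono \<^bold>\<cdot> C p \<^bold>\<cdot> C m \<^bold>\<cdot> C d \<^bold>\<cdot> (proj1 (C j) \<^bold>\<cdot> C n')) (C r) \<tturnstile> le (y (g n)) w"
      by (rule pre_extr[OF *(1) Ap_I[OF Ap_I[OF Ap_I[OF Ap_I[OF y_mono *(1)] *(2)] *(3)]
        sup_of_bound[OF *(5) n]] *(6)])
  next
    fix x v u assume "v \<in> Y x x" "u \<in> bound le A (\<lambda>n. y (g n)) x"
    note vu = this[THEN C_I]
    let ?c = "to_join (C c) (C j)"
    have "lam ''i'' (pre_trans (C p) (fibre_le (C p) (C m) (C d) (proj2 (?c \<^bold>\<cdot> V ''i'')))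
        (C u \<^bold>\<cdot> proj1 (?c \<^bold>\<cdot> V ''i''))) \<tturnstile> bound le (supp z) (\<lambda>i. k (fibre z i)) x"
      unfolding bound_def
    proof (rule rall_el_I, rule lam_I, simp)
      fix i i' assume "i' \<in> subN (supp z) i i"
      note i = C_I[OF this]
      obtain n l where nl: "proj1 (?c \<^bold>\<cdot> C i') \<tturnstile> subN A n n"
        "proj2 (?c \<^bold>\<cdot> C i') \<tturnstile> subN (supp (g n)) l l" "fibre z i \<subseteq> fibre (g n) l"
        using to_join_fibre[OF assms(1) *(4,5) i] by blast
      have "g n \<in> Mstar" using rall_el_E[OF *(4) nl(1)] by (simp add: realizes_Mstar_obj)
      moreover have "i \<in> supp z" using i by (simp add: realizes_subN)
      ultimately have "fibre_le (C p) (C m) (C d) (proj2 (?c \<^bold>\<cdot> C i')) \<tturnstile> le (k (fibre z i)) (y (g n))"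
        by (intro fibre_le[OF *(1-3) nl(2,3)])
      from pre_trans[OF *(1) this boundD[OF vu(2) nl(1)]]
      show "pre_trans (C p) (fibre_le (C p) (C m) (C d) (proj2 (?c \<^bold>\<cdot> C i'))) (C u \<^bold>\<cdot> proj1 (?c \<^bold>\<cdot> C i'))
        \<tturnstile> le (k (fibre z i)) x" .
    qed
    from pre_extl[OF *(1) sup_of_least[OF dat_sup[OF *(3) assms(2)] vu(1) this] *(6)]
    show "pre_extl (C p) (proj2 (dat_sup (C d)) \<^bold>\<cdot> C v \<^bold>\<cdot> lam ''i'' (pre_trans (C p)
      (fibre_le (C p) (C m) (C d) (proj2 (?c \<^bold>\<cdot> V ''i''))) (C u \<^bold>\<cdot> proj1 (?c \<^bold>\<cdot> V ''i'')))) (C r) \<tturnstile> le w x" .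
  }
qed

lemma subst_extend [simp]:
  "subst x a extend_mono = extend_mono" "subst x a extend_iso = extend_iso"
  "subst x a comp_represents = comp_represents" "subst x a extend_sup = extend_sup"
  by (simp_all add: extend_mono_def extend_iso_def comp_represents_def extend_sup_def)

definition "extend_joins = close (lam ''p'' (lam ''m'' (lam ''d'' (lam ''a'' (lam ''f'' (lam ''z'' (lam ''j''
  (lam ''w'' (lam ''s'' (join_of_sup \<^bold>\<cdot> V ''p'' \<^bold>\<cdot> (comp_represents \<^bold>\<cdot> (represent \<^bold>\<cdot> V ''f'') \<^bold>\<cdot> V ''d'') \<^bold>\<cdot>
    (extend_sup \<^bold>\<cdot> V ''p'' \<^bold>\<cdot> V ''m'' \<^bold>\<cdot> V ''d'' \<^bold>\<cdot> (represent_el \<^bold>\<cdot> (represent \<^bold>\<cdot> V ''f'')) \<^bold>\<cdot>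
      (sup_of_join \<^bold>\<cdot> Mstar_pre \<^bold>\<cdot> (represent \<^bold>\<cdot> V ''f'') \<^bold>\<cdot> V ''j'') \<^bold>\<cdot> proj2 (V ''s''))))))))))))"

lemma extend_joins:
  "extend_joins \<tturnstile> preord Y le \<^bold>\<longrightarrow> monotone_fun PP_obj PP_le Y le h \<^bold>\<longrightarrow> completion_data Y le h k y \<^bold>\<longrightarrow>
    preserves_joins Mstar_obj Mstar_le Y le (graph Mstar_obj Y y)"
  unfolding extend_joins_def preserves_joins_def
proof (rule close_I, ((rule rall_el_I | rule rall_I)?, rule lam_I, simp add: subst_lam)+)
  fix p m d A a \<phi> f z z' j w w' s
  assume "p \<in> preord Y le" "m \<in> monotone_fun PP_obj PP_le Y le h" "d \<in> completion_data Y le h k y"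
    "a \<in> nonempty_subsets A A" "j \<in> is_join Mstar_obj Mstar_le A \<phi> z" "s \<in> graph Mstar_obj Y y z w"
  note * = this[THEN C_I]
  assume f: "f \<in> func (subN A) Mstar_obj \<phi>"
  have A: "A \<noteq> {}"
    using *(4) unfolding nonempty_subsets_def realizes_nabla by simp
  obtain g where q: "represent \<^bold>\<cdot> C f \<tturnstile> represents Mstar_obj A \<phi> g"
    using represent[OF f] by blast
  note s = realizes_graph_Mstar[OF *(6)]
  note e = Ap_I[OF represent_el q] and j = Ap_I[OF Ap_I[OF Ap_I[OF sup_of_join Mstar_pre] q] *(5)]
  note S = Ap_I[OF Ap_I[OF Ap_I[OF Ap_I[OF Ap_I[OF Ap_I[OF extend_sup[OF A s(1)] *(1)] *(2)] *(3)] e] j] s(2)]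
  show "join_of_sup \<^bold>\<cdot> C p \<^bold>\<cdot> (comp_represents \<^bold>\<cdot> (represent \<^bold>\<cdot> C f) \<^bold>\<cdot> C d) \<^bold>\<cdot>
    (extend_sup \<^bold>\<cdot> C p \<^bold>\<cdot> C m \<^bold>\<cdot> C d \<^bold>\<cdot> (represent_el \<^bold>\<cdot> (represent \<^bold>\<cdot> C f)) \<^bold>\<cdot>
      (sup_of_join \<^bold>\<cdot> Mstar_pre \<^bold>\<cdot> (represent \<^bold>\<cdot> C f) \<^bold>\<cdot> C j) \<^bold>\<cdot> proj2 (C s))
    \<tturnstile> is_join Y le A (func_comp Mstar_obj (graph Mstar_obj Y y) \<phi>) w"
    by (rule Ap_I[OF Ap_I[OF Ap_I[OF join_of_sup *(1)] Ap_I[OF Ap_I[OF comp_represents q] *(3)]] S])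
qed

section \<open>Uniqueness of the extension\<close>

lemma preserves_joinsD:
  assumes "x \<tturnstile> preserves_joins X leX Y leY F" "a \<tturnstile> nonempty_subsets A A" "f \<tturnstile> func (subN A) X \<phi>"
    "c \<tturnstile> X z z" "j \<tturnstile> is_join X leX A \<phi> z" "b \<tturnstile> Y w w" "s \<tturnstile> F z w"
  shows "x \<^bold>\<cdot> a \<^bold>\<cdot> f \<^bold>\<cdot> c \<^bold>\<cdot> j \<^bold>\<cdot> b \<^bold>\<cdot> s \<tturnstile> is_join Y leY A (func_comp X F \<phi>) w"
proof -
  have "x \<^bold>\<cdot> a \<^bold>\<cdot> f \<tturnstile> rall (el X) (\<lambda>z. is_join X leX A \<phi> z \<^bold>\<longrightarrow>
      rall (el Y) (\<lambda>w. F z w \<^bold>\<longrightarrow> is_join Y leY A (func_comp X F \<phi>) w))"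
    using rall_E[OF rall_el_E[OF assms(1)[unfolded preserves_joins_def] assms(2)], OF assms(3)] .
  from Ap_I[OF rall_el_E[OF Ap_I[OF rall_el_E[OF this assms(4)] assms(5)] assms(6)] assms(7)]
  show ?thesis .
qed

lemma iso_funD:
  assumes "i \<tturnstile> iso_fun X Y le F F'" "a \<tturnstile> X x x" "b \<tturnstile> Y y y" "b' \<tturnstile> Y y' y'" "s \<tturnstile> F x y" "s' \<tturnstile> F' x y'"
  shows "i \<^bold>\<cdot> a \<^bold>\<cdot> b \<^bold>\<cdot> b' \<^bold>\<cdot> pair s s' \<tturnstile> iso le y y'"
  using Ap_I[OF rall_el_E[OF rall_el_E[OF rall_el_E[OF assms(1)[unfolded iso_fun_def] assms(2)] assms(3)] assms(4)]
    pair_I[OF assms(5,6)]] .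

lemma
  assumes "x \<tturnstile> is_extension P Q leQ g Y le h F"
  shows ext_mono: "proj1 x \<tturnstile> monotone_fun Q leQ Y le F"
    and ext_joins: "proj1 (proj2 x) \<tturnstile> preserves_joins Q leQ Y le F"
    and ext_iso: "proj2 (proj2 x) \<tturnstile> iso_fun P Y le (func_comp Q F g) h"
  using assms[unfolded is_extension_def] by (blast intro: proj1_I proj2_I)+

definition "canonical_sup = close (lam ''f'' (pair
  (lam ''n'' (pair E_G (pair (V ''f'') (lam ''k'' (V ''f'' \<^bold>\<cdot> V ''k'' \<^bold>\<cdot> V ''n'')))))
  (lam ''w'' (lam ''u'' (pair (V ''f'') (pair (V ''w'')
    (lam ''n'' (proj2 (proj2 (V ''u'' \<^bold>\<cdot> V ''n'')) \<^bold>\<cdot> C iden))))))))"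

text \<open>This ties an arbitrary \<open>f\<close> to the image of \<open>G\<close>. The number
  \<open>n\<close> serves both as the index and as the element of \<open>f q\<close> to which the
  realizer of \<open>E f\<close> is applied.\<close>

lemma canonical_sup:
  "canonical_sup \<tturnstile> Mstar_obj f f \<^bold>\<longrightarrow> sup_of Mstar_obj Mstar_le (supp f) (\<lambda>n. G (fibre f n)) f"
  unfolding canonical_sup_def sup_of_def bound_def[of _ _ _ f]
proof (rule close_I, rule lam_I, simp add: subst_lam, rule pair_I;
    ((rule rall_el_I)?, rule lam_I, simp add: subst_lam)+)
  fix c assume "c \<in> Mstar_obj f f"
  from C_I[OF this] have f: "f \<in> Mstar" "C c \<tturnstile> E f" by (simp_all add: realizes_Mstar_obj)
  {
    fix n n' assume "n' \<in> subN (supp f) n n"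
    then have n: "n' = n" "n \<in> supp f" by (auto simp: subN_def assembly_def split: if_splits)
    show "pair E_G (pair (C c) (lam ''k'' (C c \<^bold>\<cdot> V ''k'' \<^bold>\<cdot> C n'))) \<tturnstile> Mstar_le (G (fibre f n)) f"
    proof (intro Mstar_le_I G_Mstar fibre_nonempty n f E_G, rule lam_I, simp)
      fix p k assume "k \<in> G (fibre f n) p"
      then obtain q where "n \<in> f q" "k \<in> q \<^bold>\<longrightarrow> p" by (auto simp: G_def fibre_def)
      then show "C c \<^bold>\<cdot> C k \<^bold>\<cdot> C n' \<tturnstile> f p"
        unfolding n(1) by (intro E_D[OF f(2)] C_I)
    qed
  next
    fix w w' u assume "w' \<in> Mstar_obj w w" "u \<in> bound Mstar_le (supp f) (\<lambda>n. G (fibre f n)) w"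
    note * = this[THEN C_I]
    have w: "w \<in> Mstar" "C w' \<tturnstile> E w" using *(1) by (simp_all add: realizes_Mstar_obj)
    show "pair (C c) (pair (C w') (lam ''n'' (proj2 (proj2 (C u \<^bold>\<cdot> V ''n'')) \<^bold>\<cdot> C iden))) \<tturnstile> Mstar_le f w"
    proof (intro Mstar_le_I f w, rule lam_I, simp)
      fix p n assume n: "n \<in> f p"
      then have "C n \<tturnstile> subN (supp f) n n" by (auto simp: realizes_subN supp_def C_I)
      from Mstar_le_D(5)[OF boundD[OF *(2) this]]
      have "proj2 (proj2 (C u \<^bold>\<cdot> C n)) \<tturnstile> G (fibre f n) p \<^bold>\<longrightarrow> w p" .
      then show "proj2 (proj2 (C u \<^bold>\<cdot> C n)) \<^bold>\<cdot> C iden \<tturnstile> w p"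
        using n by (elim Ap_I) (intro C_I G_iden, simp add: fibre_def)
    qed
  }
qed

section \<open>Comparison of two extensions\<close>

definition "comp_G s = pair E_G (pair (pair (C 0) E_G) s)"

lemma comp_G:
  assumes "\<A> \<noteq> {}" "s \<tturnstile> F (G \<A>) z"
  shows "comp_G s \<tturnstile> func_comp Mstar_obj F (graph PP_obj Mstar_obj G) \<A> z"
  unfolding comp_G_def func_comp_def graph_def
  by (intro rex_el_I[where x = "G \<A>"] pair_I E_G_Mstar assms)
    (simp add: realizes_PP_obj C_UNIV assms)

definition "unique_at p t b x x' f u s v r = pre_trans p (pre_trans p
  (proj1 (proj2 (proj2 x) \<^bold>\<cdot> C 0 \<^bold>\<cdot> v \<^bold>\<cdot> proj1 (fun_total t (C 0)) \<^bold>\<cdot>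
    pair (comp_G r) (proj2 (fun_total t (C 0)))))
  (proj2 (proj2 (proj2 x') \<^bold>\<cdot> C 0 \<^bold>\<cdot> proj1 (fun_total b E_G) \<^bold>\<cdot> proj1 (fun_total t (C 0)) \<^bold>\<cdot>
    pair (comp_G (proj2 (fun_total b E_G))) (proj2 (fun_total t (C 0))))))
  (proj1 x' \<^bold>\<cdot> E_G \<^bold>\<cdot> f \<^bold>\<cdot> proj1 (fun_total b E_G) \<^bold>\<cdot> fun_cod b s \<^bold>\<cdot>
    pair (proj2 (fun_total b E_G)) (pair s u))"

text \<open>The comparison passes through \<open>h\<close>: \<open>z\<close> is isomorphic to a
  value \<open>c\<close> of \<open>h\<close> at \<open>\<A>\<close>, which is isomorphic to a value
  \<open>d\<close> of \<open>F'\<close> at \<open>G \<A>\<close>, and \<open>d\<close> lies below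
  \<open>y\<close> because \<open>F'\<close> is monotone.\<close>

lemma unique_at:
  assumes p: "p \<tturnstile> preord Y le" and t: "t \<tturnstile> func PP_obj Y h" and b: "b \<tturnstile> func Mstar_obj Y F'"
    and x: "x \<tturnstile> is_extension PP_obj Mstar_obj Mstar_le (graph PP_obj Mstar_obj G) Y le h F"
    and x': "x' \<tturnstile> is_extension PP_obj Mstar_obj Mstar_le (graph PP_obj Mstar_obj G) Y le h F'"
    and f: "f' \<tturnstile> Mstar_obj f f" and u: "u \<tturnstile> Mstar_le (G \<A>) f" and s: "s \<tturnstile> F' f y"
    and v: "v \<tturnstile> Y z z" and r: "r \<tturnstile> F (G \<A>) z" and \<A>: "\<A> \<noteq> {}"
  shows "unique_at p t b x x' f' u s v r \<tturnstile> le z y"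
proof -
  have C: "C 0 \<tturnstile> PP_obj \<A> \<A>" using \<A> by (simp add: realizes_PP_obj C_UNIV)
  obtain c where c: "proj1 (fun_total t (C 0)) \<tturnstile> Y c c" "proj2 (fun_total t (C 0)) \<tturnstile> h \<A> c"
    using rex_el_E[OF fun_total[OF t C]] by blast
  obtain d where d: "proj1 (fun_total b E_G) \<tturnstile> Y d d" "proj2 (fun_total b E_G) \<tturnstile> F' (G \<A>) d"
    using rex_el_E[OF fun_total[OF b, OF E_G_Mstar[OF \<A>]]] by blast
  note iso = iso_funD[where X = PP_obj and Y = Y and le = le and F' = h and
    F = "func_comp Mstar_obj H (graph PP_obj Mstar_obj G)" for H]
  note i = iso[OF ext_iso[OF x] C v c(1) comp_G[where F = F, OF \<A> r] c(2), unfolded iso_def]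
  note i' = iso[OF ext_iso[OF x'] C d(1) c(1) comp_G[where F = F', OF \<A> d(2)] c(2), unfolded iso_def]
  note m = monotone_funD[where F = F' and X = Mstar_obj and leX = Mstar_le and Y = Y and leY = le, OF ext_mono[OF x'] E_G_Mstar[OF \<A>] f d(1) fun_cod[OF b, OF s] d(2) s u]
  show ?thesis
    unfolding unique_at_def
    by (rule pre_trans[OF p pre_trans[OF p proj1_I[OF i] proj2_I[OF i']] m])
qed

lemma subst_unique_at [simp]:
  "subst w e (unique_at p t b x x' f u s v r) = unique_at (subst w e p) (subst w e t) (subst w e b)
    (subst w e x) (subst w e x') (subst w e f) (subst w e u) (subst w e s) (subst w e v) (subst w e r)"
  "subst w e canonical_sup = canonical_sup"
  by (simp_all add: unique_at_def comp_G_def canonical_sup_def)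

definition "image_join x a f s =
  (proj1 (proj2 x) \<^bold>\<cdot> C 0 \<^bold>\<cdot> (graph_fun \<^bold>\<cdot> assembly_obj \<^bold>\<cdot> lam ''n'' E_G) \<^bold>\<cdot> f \<^bold>\<cdot>
    (join_of_sup \<^bold>\<cdot> Mstar_pre \<^bold>\<cdot> (represent_graph \<^bold>\<cdot> lam ''n'' E_G) \<^bold>\<cdot> (canonical_sup \<^bold>\<cdot> f)) \<^bold>\<cdot>
    fun_cod a s \<^bold>\<cdot> s)"

text \<open>\<open>F\<close> preserves the canonical join of \<open>f\<close>, so a value of
  \<open>F\<close> at \<open>f\<close> is determined by the values of \<open>F\<close> on the image
  of \<open>G\<close>.\<close>

lemma image_join:
  assumes x: "x \<tturnstile> is_extension PP_obj Mstar_obj Mstar_le g Y le h F"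
    and a: "a \<tturnstile> func Mstar_obj Y F" and f: "f' \<tturnstile> Mstar_obj f f" and s: "s \<tturnstile> F f y"
  shows "image_join x a f' s \<tturnstile> is_join Y le (supp f)
    (func_comp Mstar_obj F (graph (subN (supp f)) Mstar_obj (\<lambda>n. G (fibre f n)))) y"
proof -
  have A: "C 0 \<tturnstile> nonempty_subsets (supp f) (supp f)"
    using f by (simp add: nonempty_subsets_def realizes_nabla C_UNIV supp_nonempty realizes_Mstar_obj)
  have EG: "lam ''n'' E_G \<tturnstile> rall (el (subN (supp f))) (\<lambda>n. Mstar_obj (G (fibre f n)) (G (fibre f n)))"
  proof (rule rall_el_I, rule lam_I, simp)
    fix n n' assume "n' \<in> subN (supp f) n n"
    from C_I[OF this] show "E_G \<tturnstile> Mstar_obj (G (fibre f n)) (G (fibre f n))"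
      by (intro E_G_Mstar fibre_nonempty) (simp add: realizes_subN)
  qed
  note q = Ap_I[OF represent_graph[where g = "\<lambda>n. G (fibre f n)" and Y = Mstar_obj] EG]
  note j = Ap_I[OF Ap_I[OF Ap_I[OF join_of_sup Mstar_pre] q] Ap_I[OF canonical_sup f]]
  have "assembly_obj \<tturnstile> is_object Mstar_obj" unfolding Mstar_obj_def by (rule assembly_obj)
  note G = graph_subN[where g = "\<lambda>n. G (fibre f n)", OF this EG]
  show ?thesis
    unfolding image_join_def
    by (rule preserves_joinsD[where F = F and X = Mstar_obj and Y = Y and leX = Mstar_le and leY = le, OF ext_joins[OF x] A G f j fun_cod[OF a, OF s] s])
qed

lemma subst_image_join [simp]:
  "subst w e (image_join x a f s) = image_join (subst w e x) (subst w e a) (subst w e f) (subst w e s)"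
  by (cases "w = ''n''") (simp_all add: image_join_def subst_lam)

definition "unique_le = close (lam ''p'' (lam ''t'' (lam ''a'' (lam ''b'' (lam ''x1'' (lam ''x2''
  (lam ''f'' (lam ''s1'' (lam ''s2''
  (proj2 (image_join (V ''x1'') (V ''a'') (V ''f'') (V ''s1'')) \<^bold>\<cdot> fun_cod (V ''b'') (V ''s2'') \<^bold>\<cdot>
   lam ''n'' (lam ''v'' (lam ''r'' (unique_at (V ''p'') (V ''t'') (V ''b'') (V ''x1'') (V ''x2'') (V ''f'')
     (proj1 (canonical_sup \<^bold>\<cdot> V ''f'') \<^bold>\<cdot> V ''n'') (V ''s2'') (V ''v'') (proj2 (proj2 (V ''r''))))))))))))))))"

text \<open>Join preservation is applied to \<open>F\<close> and monotonicity to \<open>F'\<close>: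
  since \<open>y\<close> is a join, it suffices that \<open>y'\<close> bounds the values of
  \<open>F\<close> on the generators. Exchanging the two extensions gives the converse.\<close>

lemma unique_le:
  fixes Y :: "'y \<Rightarrow> 'y \<Rightarrow> nat set"
  defines "ext \<equiv> is_extension PP_obj Mstar_obj Mstar_le (graph PP_obj Mstar_obj G) Y"
  shows "unique_le \<tturnstile> preord Y le \<^bold>\<longrightarrow> func PP_obj Y h \<^bold>\<longrightarrow> func Mstar_obj Y F \<^bold>\<longrightarrow> func Mstar_obj Y F' \<^bold>\<longrightarrow>
    ext le h F \<^bold>\<longrightarrow> ext le h F' \<^bold>\<longrightarrow> Mstar_obj f f \<^bold>\<longrightarrow> F f y \<^bold>\<longrightarrow> F' f y' \<^bold>\<longrightarrow> le y y'"
  unfolding unique_le_def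
proof (rule close_I, (rule lam_I, simp add: subst_lam)+)
  fix p t a b x x' c s s'
  assume "p \<in> preord Y le" "t \<in> func PP_obj Y h" "a \<in> func Mstar_obj Y F" "b \<in> func Mstar_obj Y F'"
    "x \<in> ext le h F" "x' \<in> ext le h F'" "c \<in> Mstar_obj f f" "s \<in> F f y" "s' \<in> F' f y'"
  note * = this[THEN C_I]
  note x = *(5)[unfolded ext_def] and x' = *(6)[unfolded ext_def]
  let ?u = "lam ''n'' (lam ''v'' (lam ''r'' (unique_at (C p) (C t) (C b) (C x) (C x') (C c)
     (proj1 (canonical_sup \<^bold>\<cdot> C c) \<^bold>\<cdot> V ''n'') (C s') (V ''v'') (proj2 (proj2 (V ''r''))))))"
  let ?\<phi> = "func_comp Mstar_obj F (graph (subN (supp f)) Mstar_obj (\<lambda>n. G (fibre f n)))"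
  have "?u \<tturnstile> upper_bound Y le (supp f) ?\<phi> y'"
    unfolding upper_bound_def
  proof (((rule rall_el_I)?, rule lam_I, simp add: subst_lam)+)
    fix n n' z v r
    assume "n' \<in> subN (supp f) n n" "v \<in> Y z z" "r \<in> ?\<phi> n z"
    note ** = this[THEN C_I]
    have \<A>: "fibre f n \<noteq> {}"
      using **(1) by (intro fibre_nonempty) (simp add: realizes_subN)
    show "unique_at (C p) (C t) (C b) (C x) (C x') (C c) (proj1 (canonical_sup \<^bold>\<cdot> C c) \<^bold>\<cdot> C n')
        (C s') (C v) (proj2 (proj2 (C r))) \<tturnstile> le z y'"
      by (rule unique_at[where F = F and F' = F', OF *(1,2,4) x x' *(7)
        sup_of_bound[OF Ap_I[OF canonical_sup *(7)] **(1)] *(9) **(2) func_comp_G(2)[OF **(3)] \<A>])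
  qed
  from is_join_least[OF image_join[where F = F, OF x *(3,7,8)] fun_cod[OF *(4), OF *(9)] this]
  show "proj2 (image_join (C x) (C a) (C c) (C s)) \<^bold>\<cdot> fun_cod (C b) (C s') \<^bold>\<cdot> ?u \<tturnstile> le y y'" .
qed

lemma subst_unique [simp]:
  "subst w e unique_le = unique_le" "subst w e extend_joins = extend_joins"
  by (simp_all add: unique_le_def extend_joins_def)

section \<open>Realizers of the universal property\<close>

definition "make_dat r t = make_data \<^bold>\<cdot> r \<^bold>\<cdot> t"

lemma subst_make_dat [simp]: "subst x a (make_dat r t) = make_dat (subst x a r) (subst x a t)"
  by (simp add: make_dat_def)

definition "extension r t m = pair
  (graph_fun \<^bold>\<cdot> proj1 (proj1 r) \<^bold>\<cdot> lam ''x'' (dat_y (make_dat r t)))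
  (pair (extend_mono \<^bold>\<cdot> proj1 r \<^bold>\<cdot> m \<^bold>\<cdot> make_dat r t)
  (pair (extend_joins \<^bold>\<cdot> proj1 r \<^bold>\<cdot> m \<^bold>\<cdot> make_dat r t)
    (extend_iso \<^bold>\<cdot> proj1 r \<^bold>\<cdot> t \<^bold>\<cdot> m \<^bold>\<cdot> make_dat r t)))"

text \<open>The numbers \<open>r\<close> and \<open>t\<close> are fixed first because
  \<open>k\<close> and \<open>y\<close> are picked from them; the realizer itself is a term in these
  numbers and \<open>m\<close>.\<close>

lemma extension:
  assumes r: "r \<in> preord Y le \<^bold>\<and> has_joins Y le" and t: "t \<in> func PP_obj Y h"
    and m: "m \<tturnstile> monotone_fun PP_obj PP_le Y le h"
  shows "extension (C r) (C t) m \<tturnstile>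
    rex (func Mstar_obj Y) (is_extension PP_obj Mstar_obj Mstar_le (graph PP_obj Mstar_obj G) Y le h)"
proof -
  note p = proj1_I[OF C_I[OF r]]
  obtain k y where d: "make_dat (C r) (C t) \<tturnstile> completion_data Y le h k y"
    using make_data[OF r t] unfolding make_dat_def by blast
  have "lam ''x'' (dat_y (make_dat (C r) (C t))) \<tturnstile> rall (el Mstar_obj) (\<lambda>f. Y (y f) (y f))"
  proof (rule rall_el_I, rule lam_I, simp)
    fix f a assume "a \<in> Mstar_obj f f"
    from C_I[OF this] show "dat_y (make_dat (C r) (C t)) \<tturnstile> Y (y f) (y f)"
      by (intro dat_y[OF d]) (simp add: realizes_Mstar_obj)
  qed
  note F = graph_Mstar[where g = y, OF pre_obj[OF p] this]
  note M = Ap_I[OF Ap_I[OF Ap_I[OF extend_mono p] m] d]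
    and J = Ap_I[OF Ap_I[OF Ap_I[OF extend_joins p] m] d]
    and I = Ap_I[OF Ap_I[OF Ap_I[OF Ap_I[OF extend_iso p] C_I[OF t]] m] d]
  show ?thesis
    unfolding extension_def
    by (rule rex_I, rule F) (unfold is_extension_def, rule pair_I[OF M pair_I[OF J I]])
qed

lemma subst_extension:
  "x \<noteq> ''x'' \<Longrightarrow> subst x a (extension r t m) = extension (subst x a r) (subst x a t) (subst x a m)"
  by (simp add: extension_def subst_lam)

definition "universal_realizer = close (lam ''r'' (lam ''t'' (lam ''m'' (pair
  (extension (V ''r'') (V ''t'') (V ''m''))
  (lam ''a'' (lam ''b'' (lam ''e'' (lam ''f'' (lam ''y'' (lam ''z'' (lam ''s'' (pair
    (unique_le \<^bold>\<cdot> proj1 (V ''r'') \<^bold>\<cdot> V ''t'' \<^bold>\<cdot> V ''a'' \<^bold>\<cdot> V ''b'' \<^bold>\<cdot> proj1 (V ''e'') \<^bold>\<cdot> proj2 (V ''e'') \<^bold>\<cdot> V ''f'' \<^bold>\<cdot>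
      proj1 (V ''s'') \<^bold>\<cdot> proj2 (V ''s''))
    (unique_le \<^bold>\<cdot> proj1 (V ''r'') \<^bold>\<cdot> V ''t'' \<^bold>\<cdot> V ''b'' \<^bold>\<cdot> V ''a'' \<^bold>\<cdot> proj2 (V ''e'') \<^bold>\<cdot> proj1 (V ''e'') \<^bold>\<cdot> V ''f'' \<^bold>\<cdot>
      proj2 (V ''s'') \<^bold>\<cdot> proj1 (V ''s''))))))))))))))"

lemma universal_realizer:
  "universal_realizer \<tturnstile> universal_property TYPE('y) PP_obj PP_le Mstar_obj Mstar_le (graph PP_obj Mstar_obj G)"
  unfolding universal_realizer_def universal_property_def
proof (rule close_I, (intro INTER_I)?, rule lam_I, simp add: subst_lam subst_extension, rule rall_I,
    (rule lam_I, simp add: subst_lam subst_extension)+, rule pair_I)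
  fix Y le :: "'y \<Rightarrow> 'y \<Rightarrow> nat set" and h r t m
  assume r: "r \<in> preord Y le \<^bold>\<and> has_joins Y le" and t: "t \<in> func PP_obj Y h"
    and m: "m \<in> monotone_fun PP_obj PP_le Y le h"
  let ?ext = "is_extension PP_obj Mstar_obj Mstar_le (graph PP_obj Mstar_obj G) Y le h"
  show "extension (C r) (C t) (C m) \<tturnstile> rex (func Mstar_obj Y) ?ext"
    by (rule extension[OF r t C_I[OF m]])
  show "lam ''a'' (lam ''b'' (lam ''e'' (lam ''f'' (lam ''y'' (lam ''z'' (lam ''s'' (pair
    (unique_le \<^bold>\<cdot> proj1 (C r) \<^bold>\<cdot> C t \<^bold>\<cdot> V ''a'' \<^bold>\<cdot> V ''b'' \<^bold>\<cdot> proj1 (V ''e'') \<^bold>\<cdot> proj2 (V ''e'') \<^bold>\<cdot> V ''f'' \<^bold>\<cdot>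
      proj1 (V ''s'') \<^bold>\<cdot> proj2 (V ''s''))
    (unique_le \<^bold>\<cdot> proj1 (C r) \<^bold>\<cdot> C t \<^bold>\<cdot> V ''b'' \<^bold>\<cdot> V ''a'' \<^bold>\<cdot> proj2 (V ''e'') \<^bold>\<cdot> proj1 (V ''e'') \<^bold>\<cdot> V ''f'' \<^bold>\<cdot>
      proj2 (V ''s'') \<^bold>\<cdot> proj1 (V ''s'')))))))))
    \<tturnstile> rall (func Mstar_obj Y) (\<lambda>F. rall (func Mstar_obj Y) (\<lambda>F'.
        (?ext F \<^bold>\<and> ?ext F') \<^bold>\<longrightarrow> iso_fun Mstar_obj Y le F F'))"
    unfolding iso_fun_def
  proof (((rule rall_el_I | rule rall_I)?, rule lam_I, simp add: subst_lam)+)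
    fix F a F' b e f f' y y' z z' s
    assume "a \<in> func Mstar_obj Y F" "b \<in> func Mstar_obj Y F'" "e \<in> ?ext F \<^bold>\<and> ?ext F'"
      "f' \<in> Mstar_obj f f" "s \<in> F f y \<^bold>\<and> F' f z"
    note * = this[THEN C_I]
    note e1 = proj1_I[OF *(3)] and e2 = proj2_I[OF *(3)]
      and s1 = proj1_I[OF *(5)] and s2 = proj2_I[OF *(5)]
    \<comment> \<open>\<open>unique_le\<close> is applied twice, with the two extensions
      exchanged.\<close>
    note u = Ap_I[OF Ap_I[OF unique_le proj1_I[OF C_I[OF r]]] C_I[OF t]]
    note u1 = Ap_I[OF Ap_I[OF Ap_I[OF Ap_I[OF Ap_I[OF Ap_I[OF Ap_I[OF u *(1)] *(2)] e1] e2] *(4)] s1] s2]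
    note u2 = Ap_I[OF Ap_I[OF Ap_I[OF Ap_I[OF Ap_I[OF Ap_I[OF Ap_I[OF u *(2)] *(1)] e2] e1] *(4)] s2] s1]
    show "pair
      (unique_le \<^bold>\<cdot> proj1 (C r) \<^bold>\<cdot> C t \<^bold>\<cdot> C a \<^bold>\<cdot> C b \<^bold>\<cdot> proj1 (C e) \<^bold>\<cdot> proj2 (C e) \<^bold>\<cdot> C f' \<^bold>\<cdot> proj1 (C s) \<^bold>\<cdot> proj2 (C s))
      (unique_le \<^bold>\<cdot> proj1 (C r) \<^bold>\<cdot> C t \<^bold>\<cdot> C b \<^bold>\<cdot> C a \<^bold>\<cdot> proj2 (C e) \<^bold>\<cdot> proj1 (C e) \<^bold>\<cdot> C f' \<^bold>\<cdot> proj2 (C s) \<^bold>\<cdot> proj1 (C s))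
      \<tturnstile> iso le y z"
      unfolding iso_def by (rule pair_I[OF u1 u2])
  qed
qed

theorem theorem2p3:
  shows "valid (free_completion TYPE('y)
           PP_obj PP_le Mstar_obj Mstar_le (graph PP_obj Mstar_obj G))"
  unfolding valid_def free_completion_def
  by (rule realizes_nonempty[OF pair_I[OF PP_pre pair_I[OF Mstar_pre pair_I[OF Mstar_joins
    pair_I[OF G_func pair_I[OF G_mono universal_realizer]]]]]])

end
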